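(* Assume that $A_0^i$ and $A_{22}^i$ are Hurwitz for all $i\in\mathcal I$, and let $\gamma_{11}<1$. Then there exist $\varepsilon_4^*>0$ and a function $\eta_4:(0,\varepsilon_4^* )\to[0,\infty)$ with $\eta_4(\varepsilon)=\mathcal O(\varepsilon)$ such that for all $\varepsilon\in(0,\varepsilon_4^* )$, for all sequences $(t_k)_{k\ge 0}$ of event times satisfying, for some $\tau^*$ with $\tau^*>\eta_4(\varepsilon)$, the dwell-time property $\tau_k:=t_{k+1}-t_k\ge\tau^*$ for all $k\in\mathbb N$, and for all sequences $(\sigma_k)_{k\ge0}$ in $\mathcal I$ and $(\nu_k)_{k\ge1}$ in $\mathcal J$, the singularly perturbed hybrid system (H) is globally asymptotically stable.
   Context: Setting. Let $n_x,n_z\ge1$, $n=n_x+n_z$, let $\varepsilon>0$ be a parameter and $\mathcal I,\mathcal J$ finite nonempty index sets. For each $i\in\mathcal I$, $\mathbf D^i$ is an $n\times n$ diagonal matrix with $n_z$ diagonal entries equal to $\varepsilon$ and the other $n_x$ equal to $1$ (positions may depend on $i$), and $S_i$ is a permutation matrix with $S_i\mathbf D^iS_i^\top=\mathrm{diag}(I_{n_x},\varepsilon I_{n_z})$. Let $\mathbf A^i\in\mathbb R^{n\times n}$ ($i\in\mathcal I$) and $\mathbf J^j\in\mathbb R^{n\times n}$ ($j\in\mathcal J$) be given (independent of $\varepsilon$), and set $A^i=S_i\mathbf A^iS_i^\top$, $J^{i\stackrel{j}{\to}i'}=S_{i'}\mathbf J^jS_i^\top$ for $i,i'\in\mathcal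 I$, $j\in\mathcal J$. Write in blocks of sizes $n_x,n_z$: $$A^i=\begin{pmatrix} A^i_{11} & A^i_{12} \\ A^i_{21} & A^i_{22} \end{pmatrix},$$ with $A_{22}^i$ non-singular. Set $A_0^i=A_{11}^i-A_{12}^i(A_{22}^i)^{-1}A_{21}^i$, $B_1^i=A_{12}^i$, $B_2^i=(A_{22}^i)^{-1}A_{21}^iA_0^i$, $B_3^i=(A_{22}^i)^{-1}A_{21}^iA_{12}^i$, $$P_i=\begin{pmatrix} I_{n_x} & 0 \\ (A_{22}^i)^{-1}A_{21}^i & I_{n_z} \end{pmatrix},\qquad R^{i\stackrel{j}{\to}i'}=P_{i'}J^{i\stackrel{j}{\to}i'}P_i^{-1}=\begin{pmatrix} R_{11}^{i\stackrel{j}{\to}i'} & R_{12}^{i\stackrel{j}{\to}i'} \\ R_{21}^{i\stackrel{j}{\to}i'} & R_{22}^{i\stackrel{j}{\to}i'} \end{pmatrix}.$$ A sequence of event times is a strictly increasing unbounded sequence $0=t_0<t_1<\cdots$. Given such a sequence, modes $\sigma_k\in\mathcal I$ ($k\ge0$) and $\nu_k\in\mathcal J$ ($k\ge1$), system (H) with state $(x(t),y(t))\in\mathbb R^{n_x}\times\mathbb R^{n_z}$ is, for $t\in[t_k,t_{k+1})$, $k\in\mathbb N$, $$\dot x=A_0^{\sigma_k}x+B_1^{\sigma_k}y,\qquad \varepsilon\dot y=\varepsilon B_2^{\sigma_k}x+(A_{22}^{\sigma_k}+\varepsilon B_3^{\sigma_k})y,$$ and, for $k\ge1$, $\begin{pmatrix}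 x(t_k) \\ y(t_k) \end{pmatrix}=R^{\sigma_{k-1}\stackrel{\nu_k}{\to}\sigma_k}\begin{pmatrix} x(t_k^-) \\ y(t_k^-) \end{pmatrix}$, where $t_k^-$ denotes the left limit. Globally asymptotically stable means: the origin is Lyapunov stable (for every $\rho>0$ there is $\delta>0$ such that initial states at time $0$ of norm $<\delta$ give solutions of norm $<\rho$ for all $t\ge0$) and every solution tends to $0$ as $t\to\infty$. Constants. Since $A_0^i,A_{22}^i$ are Hurwitz, fix symmetric matrices $Q_s^i\ge I_{n_x}$, $Q_f^i\ge I_{n_z}$ and numbers $\lambda_s^i,\lambda_f^i>0$ with $A_0^{i\top}Q_s^i+Q_s^iA_0^i\le-2\lambda_s^iQ_s^i$ and $A_{22}^{i\top}Q_f^i+Q_f^iA_{22}^i\le-2\lambda_f^iQ_f^i$ for all $i\in\mathcal I$. With $\|\cdot\|$ the spectral norm, put $$\gamma_{11}=\max_{i,i'\in\mathcal I,\,j\in\mathcal J}\|(Q_s^{i'})^{1/2}R_{11}^{i\stackrel{j}{\to}i'}(Q_s^i)^{-1/2}\|.$$ $\eta(\varepsilon)=\mathcal O(\varepsilon)$ for a function $\eta$ on $(0,\varepsilon^* )$ means: there are $\varepsilon_0\in(0,\varepsilon^* )$ and $c>0$ with $|\eta(\varepsilon)|\le c\varepsilon$ for all $\varepsilon\in(0,\varepsilon_0)$. *)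

theory Defs
  imports "HOL-Analysis.Analysis" "HOL-Library.Landau_Symbols"
begin

(* Block matrices: rows and columns are indexed by the disjoint sum 'nx + 'nz, so that
   CARD('nx) = n_x, CARD('nz) = n_z; Inl selects the first n_x coordinates, Inr the last n_z. *)

definition block_vec :: "real^'nx \<Rightarrow> real^'nz \<Rightarrow> real^('nx + 'nz)" where
  "block_vec x y = (\<chi> r. case r of Inl a \<Rightarrow> x $ a | Inr b \<Rightarrow> y $ b)"

definition block_mat ::
  "real^'nx^'nx \<Rightarrow> real^'nz^'nx \<Rightarrow> real^'nx^'nz \<Rightarrow> real^'nz^'nz \<Rightarrow> real^('nx + 'nz)^('nx + 'nz)"
where
  "block_mat M11 M12 M21 M22 = (\<chi> r c.
     case r of
       Inl a \<Rightarrow> (case c of Inl a' \<Rightarrow> M11 $ a $ a' | Inr b' \<Rightarrow> M12 $ a $ b')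
     | Inr b \<Rightarrow> (case c of Inl a' \<Rightarrow> M21 $ b $ a' | Inr b' \<Rightarrow> M22 $ b $ b'))"

definition blk11 :: "real^('nx::finite + 'nz::finite)^('nx + 'nz) \<Rightarrow> real^'nx^'nx" where
  "blk11 M = (\<chi> r c. M $ Inl r $ Inl c)"

definition blk12 :: "real^('nx::finite + 'nz::finite)^('nx + 'nz) \<Rightarrow> real^'nz^'nx" where
  "blk12 M = (\<chi> r c. M $ Inl r $ Inr c)"

definition blk21 :: "real^('nx::finite + 'nz::finite)^('nx + 'nz) \<Rightarrow> real^'nx^'nz" where
  "blk21 M = (\<chi> r c. M $ Inr r $ Inl c)"

definition blk22 :: "real^('nx::finite + 'nz::finite)^('nx + 'nz) \<Rightarrow> real^'nz^'nz" where
  "blk22 M = (\<chi> r c. M $ Inr r $ Inr c)"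


definition permutation_matrix :: "real^'n^'n \<Rightarrow> bool" where
  "permutation_matrix S \<longleftrightarrow> (\<exists>p. bij p \<and> S = (\<chi> r c. if c = p r then 1 else 0))"

definition hurwitz :: "real^'n^'n \<Rightarrow> bool" where
  "hurwitz M \<longleftrightarrow>
     (\<forall>(\<mu>::complex) v. v \<noteq> 0 \<and> map_matrix complex_of_real M *v v = \<mu> *s v \<longrightarrow> Re \<mu> < 0)"

definition symmetric_matrix :: "real^'n^'n \<Rightarrow> bool" where
  "symmetric_matrix M \<longleftrightarrow> transpose M = M"

definition pos_semidef :: "real^'n^'n \<Rightarrow> bool" where
  "pos_semidef M \<longleftrightarrow> symmetric_matrix M \<and> (\<forall>v. 0 \<le> v \<bullet> (M *v v))"

definition loewner_le :: "real^'n^'n \<Rightarrow> real^'n^'n \<Rightarrow> bool" where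
  "loewner_le M N \<longleftrightarrow> pos_semidef (N - M)"

(* The principal square root; meaningful for positive semidefinite Q, where it exists and
   is unique. *)
definition matrix_sqrt :: "real^'n^'n \<Rightarrow> real^'n^'n" where
  "matrix_sqrt Q = (THE T. pos_semidef T \<and> T ** T = Q)"

definition spectral_norm :: "real^'n^'m \<Rightarrow> real" where
  "spectral_norm M = onorm (\<lambda>v. M *v v)"


(* The diagonal matrix D^i of a mode: F is the set of positions of the entries equal to \<epsilon>. *)
definition scale_mat :: "'n set \<Rightarrow> real \<Rightarrow> real^'n^'n" where
  "scale_mat F \<epsilon> = (\<chi> r c. if r = c then (if r \<in> F then \<epsilon> else 1) else 0)"

(* bA and bJ below are the given (bold) matrices, in the original order of coordinates. *)
definition flow_mat :: "('i \<Rightarrow> real^'n^'n) \<Rightarrow> ('i \<Rightarrow> real^'n^'n) \<Rightarrow> 'i \<Rightarrow> real^'n^'n" where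
  "flow_mat S bA i = S i ** bA i ** transpose (S i)"

definition jump_mat ::
  "('i \<Rightarrow> real^'n^'n) \<Rightarrow> ('j \<Rightarrow> real^'n^'n) \<Rightarrow> 'i \<Rightarrow> 'j \<Rightarrow> 'i \<Rightarrow> real^'n^'n" where
  "jump_mat S bJ i j i' = S i' ** bJ j ** transpose (S i)"


definition A0 :: "real^('nx::finite + 'nz::finite)^('nx + 'nz) \<Rightarrow> real^'nx^'nx" where
  "A0 M = blk11 M - blk12 M ** matrix_inv (blk22 M) ** blk21 M"

definition B1 :: "real^('nx::finite + 'nz::finite)^('nx + 'nz) \<Rightarrow> real^'nz^'nx" where
  "B1 M = blk12 M"

definition B2 :: "real^('nx::finite + 'nz::finite)^('nx + 'nz) \<Rightarrow> real^'nx^'nz" where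
  "B2 M = matrix_inv (blk22 M) ** blk21 M ** A0 M"

definition B3 :: "real^('nx::finite + 'nz::finite)^('nx + 'nz) \<Rightarrow> real^'nz^'nz" where
  "B3 M = matrix_inv (blk22 M) ** blk21 M ** blk12 M"

definition P_mat ::
  "real^('nx::finite + 'nz::finite)^('nx + 'nz) \<Rightarrow> real^('nx + 'nz)^('nx + 'nz)" where
  "P_mat M = block_mat (mat 1) 0 (matrix_inv (blk22 M) ** blk21 M) (mat 1)"

definition R_mat ::
  "('i \<Rightarrow> real^('nx::finite + 'nz::finite)^('nx + 'nz)) \<Rightarrow> ('i \<Rightarrow> real^('nx + 'nz)^('nx + 'nz)) \<Rightarrow>
   ('j \<Rightarrow> real^('nx + 'nz)^('nx + 'nz)) \<Rightarrow> 'i \<Rightarrow> 'j \<Rightarrow> 'i \<Rightarrow> real^('nx + 'nz)^('nx + 'nz)"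
where
  "R_mat S bA bJ i j i' =
     P_mat (flow_mat S bA i') ** jump_mat S bJ i j i' ** matrix_inv (P_mat (flow_mat S bA i))"

definition gamma11 ::
  "('i::finite \<Rightarrow> real^('nx::finite + 'nz::finite)^('nx + 'nz)) \<Rightarrow>
   ('i \<Rightarrow> real^('nx + 'nz)^('nx + 'nz)) \<Rightarrow> ('j::finite \<Rightarrow> real^('nx + 'nz)^('nx + 'nz)) \<Rightarrow>
   ('i \<Rightarrow> real^'nx^'nx) \<Rightarrow> real"
where
  "gamma11 S bA bJ Qs =
     Max (range (\<lambda>(i, j, i').
       spectral_norm (matrix_sqrt (Qs i') ** blk11 (R_mat S bA bJ i j i')
                        ** matrix_inv (matrix_sqrt (Qs i)))))"


definition event_times :: "(nat \<Rightarrow> real) \<Rightarrow> bool" where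
  "event_times t \<longleftrightarrow> t 0 = 0 \<and> strict_mono t \<and> \<not> bdd_above (range t)"

(* Solutions of the hybrid system (H) on [0,\<infinity>). The derivative at the left end point of an
   interval [t k, t (k+1)) is one-sided. \<nu> is used only at indices k >= 1, and the values of
   x and y at negative times are irrelevant. *)
definition hybrid_solution ::
  "('i \<Rightarrow> real^('nx::finite + 'nz::finite)^('nx + 'nz)) \<Rightarrow> ('i \<Rightarrow> real^('nx + 'nz)^('nx + 'nz)) \<Rightarrow>
   ('j \<Rightarrow> real^('nx + 'nz)^('nx + 'nz)) \<Rightarrow> real \<Rightarrow>
   (nat \<Rightarrow> real) \<Rightarrow> (nat \<Rightarrow> 'i) \<Rightarrow> (nat \<Rightarrow> 'j) \<Rightarrow>
   (real \<Rightarrow> real^'nx) \<Rightarrow> (real \<Rightarrow> real^'nz) \<Rightarrow> bool"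
where
  "hybrid_solution S bA bJ \<epsilon> t \<sigma> \<nu> x y \<longleftrightarrow>
     (\<forall>k. \<forall>s\<in>{t k..<t (Suc k)}. \<exists>x' y'.
        let A = flow_mat S bA (\<sigma> k) in
        (x has_vector_derivative x') (at s within {t k..<t (Suc k)}) \<and>
        (y has_vector_derivative y') (at s within {t k..<t (Suc k)}) \<and>
        x' = A0 A *v x s + B1 A *v y s \<and>
        \<epsilon> *\<^sub>R y' = \<epsilon> *\<^sub>R (B2 A *v x s) + (blk22 A + \<epsilon> *\<^sub>R B3 A) *v y s) \<and>
     (\<forall>k\<ge>1. \<exists>xm ym.
        (x \<longlongrightarrow> xm) (at_left (t k)) \<and> (y \<longlongrightarrow> ym) (at_left (t k)) \<and>
        block_vec (x (t k)) (y (t k)) =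
          R_mat S bA bJ (\<sigma> (k - 1)) (\<nu> k) (\<sigma> k) *v block_vec xm ym)"

(* The system is represented by the predicate singling out its solutions. *)
definition globally_asymptotically_stable ::
  "((real \<Rightarrow> real^'nx) \<Rightarrow> (real \<Rightarrow> real^'nz) \<Rightarrow> bool) \<Rightarrow> bool" where
  "globally_asymptotically_stable sol \<longleftrightarrow>
     (\<forall>\<rho>>0. \<exists>\<delta>>0. \<forall>x y. sol x y \<and> norm (x 0, y 0) < \<delta> \<longrightarrow> (\<forall>s\<ge>0. norm (x s, y s) < \<rho>)) \<and>
     (\<forall>x y. sol x y \<longrightarrow> ((\<lambda>s. (x s, y s)) \<longlongrightarrow> 0) at_top)"

end

theory Submission
  imports Defs
begin

text \<open>
  With the quadratic forms \<open>u = x\<^sup>T Q\<^sub>s x\<close> and \<open>w = y\<^sup>T Q\<^sub>f y\<close> of the active mode, the flow satisfies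
  \<open>u' \<le> - l u + K w\<close> and \<open>w' \<le> - (f / \<epsilon>) w + K u\<close> for small \<open>\<epsilon>\<close>. With \<open>e = \<epsilon> K / f\<close> the sum
  \<open>u + e w\<close> is nonincreasing, so between two events \<open>u\<close> grows by at most \<open>e w\<close>, while \<open>w\<close> decays like
  \<open>exp (- f s / \<epsilon>)\<close> up to an error \<open>O(\<epsilon>)\<close>. A jump gives \<open>u\<^sup>+ \<le> g u + M w\<close> with \<open>g < 1\<close>, because
  \<open>\<gamma>\<^sub>1\<^sub>1 < 1\<close>, and \<open>w\<^sup>+ \<le> M (u + w)\<close>. Hence for a small fixed weight \<open>\<mu>\<close> the function \<open>u + \<mu> w\<close>
  contracts by a fixed factor from one event to the next as soon as \<open>exp (- f \<tau> / \<epsilon>)\<close> is below a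
  constant independent of \<open>\<epsilon>\<close>, that is, for dwell times beyond a multiple of \<open>\<epsilon>\<close>.
\<close>

subsection \<open>Square roots of positive definite matrices\<close>

text \<open>The eigenvector maximises \<open>x \<bullet> f x\<close> over the unit sphere of \<open>S\<close>.\<close>
lemma self_adjoint_eigenvector:
  fixes f :: "'a::euclidean_space \<Rightarrow> 'a"
  assumes lin: "linear f" and sa: "\<And>x y. f x \<bullet> y = x \<bullet> f y"
    and S: "subspace S" "\<And>x. x \<in> S \<Longrightarrow> f x \<in> S" "S \<noteq> {0}"
  obtains v where "v \<in> S" "norm v = 1" "f v = (v \<bullet> f v) *\<^sub>R v"
proof -
  have cf: "continuous_on X f" for X
    using lin linear_continuous_on linear_linear by blast
  have "compact (sphere 0 1 \<inter> S)"
    by (simp add: closed_subspace compact_Int_closed S)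
  moreover obtain z where z: "z \<in> S" "z \<noteq> 0" using S subspace_0 by blast
  hence "(1 / norm z) *\<^sub>R z \<in> sphere 0 1 \<inter> S" by (simp add: S subspace_scale)
  moreover have "continuous_on (sphere 0 1 \<inter> S) (\<lambda>x. x \<bullet> f x)"
    by (intro continuous_intros cf)
  ultimately obtain v where v: "v \<in> sphere 0 1 \<inter> S"
      and vmax: "\<And>x. x \<in> sphere 0 1 \<inter> S \<Longrightarrow> x \<bullet> f x \<le> v \<bullet> f v"
    using continuous_attains_sup[of "sphere 0 1 \<inter> S" "\<lambda>x. x \<bullet> f x"] by blast
  define l where "l = v \<bullet> f v"
  have vS: "v \<in> S" and v1: "norm v = 1" using v by auto
  have le: "x \<bullet> f x \<le> l * (x \<bullet> x)" if "x \<in> S" for x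
  proof (cases "x = 0")
    case False
    have "(1 / norm x) *\<^sub>R x \<in> sphere 0 1 \<inter> S"
      using False that by (simp add: S subspace_scale)
    from vmax[OF this] have "(x \<bullet> f x) / (norm x)\<^sup>2 \<le> l"
      by (simp add: linear_cmul[OF lin] l_def power2_eq_square)
    thus ?thesis using False by (simp add: power2_norm_eq_inner field_simps)
  qed (simp add: linear_0[OF lin])
  \<comment> \<open>The residual \<open>w\<close> is orthogonal to \<open>v\<close>, and moving from
    \<open>v\<close> to \<open>v + t *\<^sub>R w\<close> changes the form at first order by
    \<open>2 * t * (w \<bullet> w)\<close>. Maximality allows only second-order growth, so the
    residual must vanish.\<close>
  define w where "w = f v - l *\<^sub>R v"
  have wS: "w \<in> S" unfolding w_def by (intro subspace_diff subspace_scale S vS)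
  have vv: "v \<bullet> v = 1" using v1 by (simp add: norm_eq_1)
  have wv: "w \<bullet> v = 0" by (simp add: w_def inner_diff_left vv l_def inner_commute[of "f v" v])
  have wfv: "w \<bullet> f v = w \<bullet> w"
    using wv by (simp add: w_def inner_diff_right)
  define c where "c = l * (w \<bullet> w) - w \<bullet> f w"
  have c0: "c \<ge> 0" using le[OF wS] by (simp add: c_def)
  have quad: "2 * t * (w \<bullet> w) \<le> t^2 * c" for t
  proof -
    have "v + t *\<^sub>R w \<in> S" by (intro subspace_add subspace_scale S vS wS)
    note le[OF this]
    moreover have "(v + t *\<^sub>R w) \<bullet> (v + t *\<^sub>R w) = 1 + t^2 * (w \<bullet> w)"
      using wv vv by (simp add: inner_add_left inner_add_right inner_commute[of v w] power2_eq_square)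
    moreover have "v \<bullet> f w = w \<bullet> w" using sa[of v w] wfv by (simp add: inner_commute[of "f v"])
    hence "(v + t *\<^sub>R w) \<bullet> f (v + t *\<^sub>R w) = l + 2 * t * (w \<bullet> w) + t^2 * (w \<bullet> f w)"
      using wfv by (simp add: linear_add[OF lin] linear_cmul[OF lin] inner_add_left inner_add_right
          l_def power2_eq_square distrib_left)
    ultimately have "l + 2 * t * (w \<bullet> w) + t^2 * (w \<bullet> f w) \<le> l * (1 + t^2 * (w \<bullet> w))" by metis
    thus ?thesis by (simp add: c_def algebra_simps)
  qed
  have "w \<bullet> w = 0"
  proof (rule ccontr)
    assume "w \<bullet> w \<noteq> 0"
    hence p: "w \<bullet> w > 0" by simp
    \<comment> \<open>Small enough for the linear term to beat \<open>t^2 * c\<close>; the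
      \<open>+ 1\<close> keeps the denominator positive when \<open>c = 0\<close>.\<close>
    define t where "t = (w \<bullet> w) / (c + 1)"
    have t: "t > 0" "t * c \<le> w \<bullet> w" using p c0 by (auto simp: t_def divide_simps)
    have "t * (2 * (w \<bullet> w)) \<le> t * (t * c)" using quad[of t] by (simp add: power2_eq_square mult.assoc mult.left_commute)
    hence "2 * (w \<bullet> w) \<le> t * c" using t(1) mult_le_cancel_left_pos by blast
    with t(2) p show False by linarith
  qed
  hence "f v = l *\<^sub>R v" by (simp add: w_def)
  thus ?thesis using that vS v1 l_def by blast
qed

text \<open>Induction on the dimension: split off a unit eigenvector \<open>v\<close> and recurse on
  its orthogonal complement within \<open>S\<close>. The complement is invariant because
  self-adjointness gives \<open>v \<bullet> f y = f v \<bullet> y\<close>, a multiple of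
  \<open>v \<bullet> y\<close>.\<close>

lemma self_adjoint_eigenbasis:
  fixes f :: "'a::euclidean_space \<Rightarrow> 'a"
  assumes lin: "linear f" and sa: "\<And>x y. f x \<bullet> y = x \<bullet> f y"
    and "subspace S" "\<And>x. x \<in> S \<Longrightarrow> f x \<in> S"
  shows "\<exists>B. finite B \<and> pairwise orthogonal B \<and> span B = S \<and>
            (\<forall>b\<in>B. norm b = 1 \<and> f b = (b \<bullet> f b) *\<^sub>R b)"
  using assms(3,4)
proof (induction "dim S" arbitrary: S rule: less_induct)
  case less
  show ?case
  proof (cases "S = {0}")
    case True
    thus ?thesis by (intro exI[of _ "{}"]) auto
  next
    case False
    obtain v where v: "v \<in> S" "norm v = 1" "f v = (v \<bullet> f v) *\<^sub>R v"
      using self_adjoint_eigenvector[OF lin sa less.prems(1,2) False] by blast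
    define S' where "S' = {y \<in> S. v \<bullet> y = 0}"
    have sub: "subspace S'"
      using less.prems(1) by (auto simp: S'_def subspace_def inner_add_right)
    have inv: "f y \<in> S'" if "y \<in> S'" for y
    proof -
      have "v \<bullet> f y = (v \<bullet> f v) * (v \<bullet> y)"
        using sa[of v y] v(3) by (metis inner_scaleR_left)
      thus ?thesis using that less.prems(2) by (auto simp: S'_def)
    qed
    have "v \<notin> S'" using v by (auto simp: S'_def)
    hence "S' \<subset> S" using v unfolding S'_def by blast
    hence "dim S' < dim S"
      using sub less.prems(1) by (metis dim_psubset span_eq_iff)
    from less.hyps[OF this sub inv] obtain B where B: "finite B" "pairwise orthogonal B"
      "span B = S'" "\<forall>b\<in>B. norm b = 1 \<and> f b = (b \<bullet> f b) *\<^sub>R b" by blast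
    have BS': "B \<subseteq> S'" using B(3) span_superset by blast
    have "span (insert v B) = S"
    proof
      show "span (insert v B) \<subseteq> S"
        using BS' v less.prems(1) by (intro span_minimal) (auto simp: S'_def)
      show "S \<subseteq> span (insert v B)"
      proof
        fix x assume "x \<in> S"
        hence "x - (v \<bullet> x) *\<^sub>R v \<in> S'"
          using v less.prems(1) by (auto simp: S'_def subspace_diff subspace_scale inner_diff_right norm_eq_1)
        thus "x \<in> span (insert v B)" using B(3) span_breakdown_eq by blast
      qed
    qed
    moreover have "pairwise orthogonal (insert v B)"
      using B(2) BS' by (auto simp: pairwise_insert orthogonal_def S'_def inner_commute)
    ultimately show ?thesis using B v by (intro exI[of _ "insert v B"]) auto
  qed
qed

section \<open>Symmetric matrices and the principal square root\<close>

lemma symmetric_matrix_inner: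
  assumes "symmetric_matrix M"
  shows "(M *v x) \<bullet> y = x \<bullet> (M *v y)"
  using assms by (metis symmetric_matrix_def dot_lmul_matrix vector_transpose_matrix)

lemma symmetric_matrixI:
  assumes "\<And>x y. (M *v x) \<bullet> y = x \<bullet> (M *v y)"
  shows "symmetric_matrix M"
proof -
  have "(transpose M *v x) \<bullet> y = (M *v x) \<bullet> y" for x y
    unfolding assms transpose_matrix_vector dot_lmul_matrix ..
  hence "transpose M *v x = M *v x" for x
    using vector_eq_rdot[of "transpose M *v x" "M *v x"] by blast
  thus ?thesis unfolding symmetric_matrix_def matrix_eq by blast
qed

text \<open>Since \<open>matrix_sqrt\<close> is a definite description, nothing is known about it
  before existence and uniqueness are both proved. Existence takes square roots of the eigenvalues
  in an orthonormal eigenbasis \<open>B\<close>; uniqueness is checked on each vector of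
  \<open>B\<close>.\<close>

lemma matrix_sqrt_pos_def:
  fixes Q :: "real^'n^'n"
  assumes sym: "symmetric_matrix Q" and pos: "\<And>v. v \<noteq> 0 \<Longrightarrow> 0 < v \<bullet> (Q *v v)"
  shows "pos_semidef (matrix_sqrt Q)" "matrix_sqrt Q ** matrix_sqrt Q = Q"
proof -
  obtain B where B: "finite B" "pairwise orthogonal B" "span B = (UNIV :: (real^'n) set)"
    "\<And>b. b \<in> B \<Longrightarrow> norm b = 1" "\<And>b. b \<in> B \<Longrightarrow> Q *v b = (b \<bullet> (Q *v b)) *\<^sub>R b"
    using self_adjoint_eigenbasis[of "(*v) Q" UNIV]
    by (auto simp: symmetric_matrix_inner[OF sym])
  define l where "l b = b \<bullet> (Q *v b)" for b
  have lpos: "l b > 0" if "b \<in> B" for b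
  proof -
    have "b \<noteq> 0" using B(4)[OF that] by auto
    thus ?thesis using pos by (simp add: l_def)
  qed
  have Ql: "Q *v b = l b *\<^sub>R b" if "b \<in> B" for b using B(5)[OF that] by (simp add: l_def)
  define g where "g x = (\<Sum>b\<in>B. (sqrt (l b) * (b \<bullet> x)) *\<^sub>R b)" for x
  have "linear g" unfolding g_def
    by (intro linear_compose_sum ballI linearI)
       (simp_all add: inner_add_right distrib_left scaleR_add_left)
  define T where "T = matrix g"
  have Tv: "T *v x = g x" for x using \<open>linear g\<close> by (simp add: T_def)
  have gb: "g b = sqrt (l b) *\<^sub>R b" if "b \<in> B" for b
  proof -
    have "g b = (\<Sum>c\<in>B. if c = b then sqrt (l b) *\<^sub>R b else 0)"
      unfolding g_def
    proof (rule sum.cong)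
      fix c assume "c \<in> B"
      show "(sqrt (l c) * (c \<bullet> b)) *\<^sub>R c = (if c = b then sqrt (l b) *\<^sub>R b else 0)"
        using B(2,4) that \<open>c \<in> B\<close> by (auto simp: pairwise_def orthogonal_def norm_eq_1)
    qed simp
    thus ?thesis using that B(1) by simp
  qed
  have eqB: "M = N" if "\<And>b. b \<in> B \<Longrightarrow> M *v b = N *v b" for M N :: "real^'n^'n"
    using linear_eq_on_span[of "(*v) M" "(*v) N" B] that B(3)
    unfolding matrix_eq by auto
  have "pos_semidef T"
    unfolding pos_semidef_def
  proof (intro conjI allI symmetric_matrixI)
    show "(T *v x) \<bullet> y = x \<bullet> (T *v y)" for x y
      by (simp add: Tv g_def inner_sum_left inner_sum_right inner_commute mult_ac)
    show "0 \<le> v \<bullet> (T *v v)" for v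
    proof -
      have "v \<bullet> (T *v v) = (\<Sum>b\<in>B. sqrt (l b) * (b \<bullet> v)\<^sup>2)"
        by (simp add: Tv g_def inner_sum_right inner_commute[of v] power2_eq_square mult.assoc)
      also have "\<dots> \<ge> 0"
        using lpos by (intro sum_nonneg mult_nonneg_nonneg) (auto simp: less_imp_le)
      finally show ?thesis .
    qed
  qed
  moreover have "T ** T = Q"
  proof (rule eqB)
    fix b assume b: "b \<in> B"
    have "(T ** T) *v b = T *v (sqrt (l b) *\<^sub>R b)"
      by (simp add: matrix_vector_mul_assoc[symmetric] Tv[of b] gb[OF b])
    also have "\<dots> = Q *v b"
      using lpos[OF b] by (simp add: matrix_vector_mult_scaleR Tv gb[OF b] Ql[OF b])
    finally show "(T ** T) *v b = Q *v b" .
  qed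
  moreover have "T' = T" if T': "pos_semidef T' \<and> T' ** T' = Q" for T'
  proof (rule eqB)
    fix b assume b: "b \<in> B"
    \<comment> \<open>A nonzero \<open>w\<close> would be an eigenvector of \<open>T'\<close> for
      the negative eigenvalue \<open>- sqrt (l b)\<close>, which positive semidefiniteness
      excludes.\<close>
    define w where "w = T' *v b - sqrt (l b) *\<^sub>R b"
    have "T' *v (T' *v b) = l b *\<^sub>R b" using T' Ql[OF b] by (simp add: matrix_vector_mul_assoc)
    hence "T' *v w = - sqrt (l b) *\<^sub>R w"
      using lpos[OF b]
      by (simp add: w_def matrix_vector_mult_diff_distrib matrix_vector_mult_scaleR scaleR_diff_right)
    moreover have "0 \<le> w \<bullet> (T' *v w)" using T' by (simp add: pos_semidef_def)
    ultimately have "sqrt (l b) * (w \<bullet> w) \<le> 0" by simp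
    hence "w \<bullet> w \<le> 0" using lpos[OF b] by (simp add: mult_le_0_iff)
    hence "w = 0" by (metis inner_eq_zero_iff inner_ge_zero antisym)
    thus "T' *v b = T *v b" by (simp add: w_def Tv gb[OF b])
  qed
  ultimately have "matrix_sqrt Q = T" unfolding matrix_sqrt_def by (intro the_equality) blast+
  thus "pos_semidef (matrix_sqrt Q)" "matrix_sqrt Q ** matrix_sqrt Q = Q"
    using \<open>pos_semidef T\<close> \<open>T ** T = Q\<close> by auto
qed

subsection \<open>Two-time-scale Lyapunov estimates\<close>

text \<open>At interior points the derivative within the interval is an ordinary two-sided one. At
  \<open>a\<close>, where it is only one-sided, the mean value argument asks for continuity
  alone.\<close>

lemma nonincreasing_from_left_endpoint:
  fixes F :: "real \<Rightarrow> real"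
  assumes D: "\<And>s. s \<in> {a..<b} \<Longrightarrow> \<exists>d\<le>0. (F has_real_derivative d) (at s within {a..<b})"
    and s: "s \<in> {a..<b}"
  shows "F s \<le> F a"
proof (rule DERIV_nonpos_imp_decreasing_open[where f = F])
  show "a \<le> s" using s by simp
  show "\<exists>d. DERIV F r :> d \<and> d \<le> 0" if "a < r" "r < s" for r
  proof -
    have "r \<in> interior {a..<b}" using that s by simp
    hence "at r within {a..<b} = at r" by (rule at_within_interior)
    thus ?thesis using D[of r] that s by auto
  qed
  have "continuous_on {a..<b} F"
    unfolding continuous_on_eq_continuous_within using D DERIV_continuous by blast
  thus "continuous_on {a..s} F" by (rule continuous_on_subset) (use s in auto)
qed

text \<open>The Lyapunov function \<open>u + e w\<close> is nonincreasing, and then \<open>exp (f / \<epsilon> (s - a)) (w - e U)\<close>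
  is nonincreasing, where \<open>U\<close> bounds \<open>u\<close>.\<close>
lemma two_time_scale_flow:
  fixes u w :: "real \<Rightarrow> real"
  assumes D: "\<And>s. s \<in> {a..<b} \<Longrightarrow> \<exists>u' w'.
        (u has_real_derivative u') (at s within {a..<b}) \<and>
        (w has_real_derivative w') (at s within {a..<b}) \<and>
        u' \<le> - l * u s + K * w s \<and> w' \<le> - (f / \<epsilon>) * w s + K * u s"
    and nonneg: "\<And>s. 0 \<le> u s" "\<And>s. 0 \<le> w s"
    and pos: "0 < \<epsilon>" "0 < f" "0 < K"
    and e: "e = \<epsilon> * K / f" "e * K \<le> l"
    and s: "s \<in> {a..<b}"
  shows "u s \<le> u a + e * w a"
    and "w s \<le> exp (- (f / \<epsilon>) * (s - a)) * w a + e * (u a + e * w a)"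
proof -
  \<comment> \<open>The weight \<open>e\<close> is tuned so that the decay of \<open>e * w\<close>
    exactly cancels the term \<open>K * w\<close> in the bound on \<open>u'\<close>; the assumption
    \<open>e * K \<le> l\<close> lets the decay of \<open>u\<close> absorb the opposite
    coupling.\<close>
  have e0: "e \<ge> 0" and fe: "f / \<epsilon> * e = K" using pos e(1) by auto
  have uU: "u s \<le> u a + e * w a" if s: "s \<in> {a..<b}" for s
  proof -
    have "(\<lambda>s. u s + e * w s) s \<le> (\<lambda>s. u s + e * w s) a"
    proof (rule nonincreasing_from_left_endpoint[OF _ s])
      fix r assume "r \<in> {a..<b}"
      from D[OF this] obtain u' w' where
        d: "(u has_real_derivative u') (at r within {a..<b})"
           "(w has_real_derivative w') (at r within {a..<b})"
        and le: "u' \<le> - l * u r + K * w r" "w' \<le> - (f / \<epsilon>) * w r + K * u r" by blast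
      have "e * w' \<le> e * (- (f / \<epsilon>) * w r + K * u r)"
        using le(2) e0 by (rule mult_left_mono)
      also have "\<dots> = - (f / \<epsilon> * e) * w r + (e * K) * u r" by (simp add: algebra_simps)
      also have "\<dots> \<le> - K * w r + l * u r"
        unfolding fe using e(2) nonneg(1)[of r] by (simp add: mult_right_mono)
      finally have "u' + e * w' \<le> 0" using le(1) by simp
      thus "\<exists>d\<le>0. ((\<lambda>s. u s + e * w s) has_real_derivative d) (at r within {a..<b})"
        using d by (intro exI[of _ "u' + e * w'"]) (auto intro!: derivative_eq_intros)
    qed
    thus ?thesis using mult_nonneg_nonneg[OF e0 nonneg(2)[of s]] by simp
  qed
  show "u s \<le> u a + e * w a" using uU s by blast
  define U where "U = u a + e * w a"
  have U0: "0 \<le> U" using nonneg e0 by (simp add: U_def)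
  \<comment> \<open>\<open>e * U\<close> is the equilibrium of the comparison equation
    \<open>w' = - (f / \<epsilon>) * w + K * U\<close>, and the exponential is its integrating
    factor.\<close>
  define G where "G s = exp (f / \<epsilon> * (s - a)) * (w s - e * U)" for s
  have "G s \<le> G a"
  proof (rule nonincreasing_from_left_endpoint[OF _ s])
    fix r assume r: "r \<in> {a..<b}"
    from D[OF this] obtain w' where
      d: "(w has_real_derivative w') (at r within {a..<b})"
      and le: "w' \<le> - (f / \<epsilon>) * w r + K * u r" by blast
    define E where "E = exp (f / \<epsilon> * (r - a))"
    have "(G has_real_derivative E * (f / \<epsilon> * (w r - e * U) + w')) (at r within {a..<b})"
      unfolding G_def E_def
      using pos by (auto intro!: derivative_eq_intros d simp: algebra_simps)
    moreover have "E * (f / \<epsilon> * (w r - e * U) + w') \<le> 0"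
    proof -
      have "f / \<epsilon> * (w r - e * U) + w' \<le> K * u r - (f / \<epsilon> * e) * U"
        using le by (simp add: algebra_simps)
      also have "\<dots> \<le> 0"
        unfolding fe using uU[OF r] pos by (simp add: U_def)
      finally show ?thesis by (intro mult_nonneg_nonpos) (auto simp: E_def)
    qed
    ultimately show "\<exists>d\<le>0. (G has_real_derivative d) (at r within {a..<b})" by blast
  qed
  hence "exp (- (f / \<epsilon>) * (s - a)) * G s \<le> exp (- (f / \<epsilon>) * (s - a)) * G a"
    by (rule mult_left_mono) simp
  moreover have "exp (- (f / \<epsilon>) * (s - a)) * G s = w s - e * U"
    by (simp add: G_def mult.assoc[symmetric] exp_add[symmetric])
  moreover have "G a = w a - e * U" by (simp add: G_def)
  ultimately have "w s - e * U \<le> exp (- (f / \<epsilon>) * (s - a)) * (w a - e * U)" by metis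
  also have "\<dots> \<le> exp (- (f / \<epsilon>) * (s - a)) * w a"
    using e0 U0 by (intro mult_left_mono) auto
  finally show "w s \<le> exp (- (f / \<epsilon>) * (s - a)) * w a + e * (u a + e * w a)"
    by (simp add: U_def)
qed

text \<open>Here \<open>e\<close> stands for the coupling of order \<epsilon> and \<open>E\<close>
  for the decay factor of the fast part between events. The weight \<mu> is fixed first, by the gap
  \<open>1 - g\<close>; only then are the thresholds for \<open>e\<close> and \<open>E\<close>
  chosen, relative to \<mu>.\<close>

lemma contraction_parameters:
  fixes g M :: real
  assumes "0 \<le> g" "g < 1" "0 < M"
  obtains \<mu> q \<delta> \<kappa> where "0 < \<mu>" "0 < q" "q < 1" "0 < \<delta>" "0 < \<kappa>"
    "\<And>e E a b. \<lbrakk>0 \<le> e; e \<le> \<delta>; 0 \<le> E; E \<le> \<kappa>; 0 \<le> a; 0 \<le> b\<rbrakk> \<Longrightarrow>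
       (g + \<mu> * M) * (a + e * b) + (M + \<mu> * M) * (E * b + e * (a + e * b)) \<le> q * (a + \<mu> * b)"
proof -
  define d where "d = 1 - g"
  define \<mu> where "\<mu> = d / (4 * M)"
  define M' where "M' = M + \<mu> * M"
  \<comment> \<open>The midpoint between \<open>g\<close> and 1: in the coefficient of
    \<open>a\<close>, the terms \<open>\<mu> * M\<close> and \<open>M' * e\<close> each use up a
    quarter of the gap \<open>d\<close>.\<close>
  define q where "q = g + d / 2"
  have d: "0 < d" "d \<le> 1" using assms by (auto simp: d_def)
  have mu: "0 < \<mu>" "\<mu> * M = d / 4" using d assms by (auto simp: \<mu>_def)
  have M': "0 < M'" using mu assms by (simp add: M'_def add_pos_pos)
  have q: "0 < q" "q < 1" using assms by (simp_all add: q_def d_def field_simps)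
  \<comment> \<open>In the coefficient of \<open>b\<close>, which may reach
    \<open>q * \<mu>\<close>, one half is reserved for \<open>M' * E\<close> and the other for the
    terms with \<open>e\<close>. The bound \<open>e \<le> 1\<close> serves to replace
    \<open>e * e\<close> by \<open>e\<close>.\<close>
  define \<kappa> where "\<kappa> = \<mu> * q / (2 * M')"
  define \<delta> where "\<delta> = min 1 (min (d / (4 * M')) (\<mu> * q / (2 * (1 + M'))))"
  have "(g + \<mu> * M) * (a + e * b) + M' * (E * b + e * (a + e * b)) \<le> q * (a + \<mu> * b)"
    if *: "0 \<le> e" "e \<le> \<delta>" "0 \<le> E" "E \<le> \<kappa>" "0 \<le> a" "0 \<le> b" for e E a b
  proof -
    have e1: "e \<le> 1" and "e \<le> d / (4 * M')" and "e \<le> \<mu> * q / (2 * (1 + M'))"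
      using * by (auto simp: \<delta>_def)
    hence e2: "M' * e \<le> d / 4" and e3: "(1 + M') * e \<le> \<mu> * q / 2"
      using M' by (auto simp: field_simps)
    have E: "M' * E \<le> \<mu> * q / 2" using *(4) M' by (auto simp: \<kappa>_def field_simps)
    have "e * e \<le> e" using e1 *(1) by (simp add: mult_left_le)
    hence ee: "M' * (e * e) \<le> M' * e" using M' by simp
    have g1: "g + \<mu> * M \<le> 1" using mu d by (simp add: d_def)
    have "(g + \<mu> * M) * e \<le> e" using mult_right_mono[OF g1 *(1)] by simp
    hence "(g + \<mu> * M) * e + M' * E + M' * (e * e) \<le> q * \<mu>"
      using e3 E ee by (simp add: algebra_simps)
    moreover have "g + \<mu> * M + M' * e \<le> q" using e2 mu by (simp add: q_def)
    ultimately have "(g + \<mu> * M + M' * e) * a + ((g + \<mu> * M) * e + M' * E + M' * (e * e)) * b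
        \<le> q * a + q * \<mu> * b"
      using *(5,6) by (intro add_mono mult_right_mono) auto
    thus ?thesis by (simp add: algebra_simps)
  qed
  moreover have "0 < \<delta>" "0 < \<kappa>" using d mu M' q by (auto simp: \<delta>_def \<kappa>_def)
  ultimately show thesis using that mu q unfolding M'_def by blast
qed

text \<open>The function \<open>u k\<close> is the slow Lyapunov function of the mode active on the
  \<open>k\<close>-th interval, \<open>w k\<close> the fast one; \<open>um k\<close> and \<open>wm k\<close> are their left limits at the next event.\<close>
lemma hybrid_lyapunov_estimate:
  fixes u w :: "nat \<Rightarrow> real \<Rightarrow> real" and um wm :: "nat \<Rightarrow> real"
  assumes t: "strict_mono t"
    and D: "\<And>k s. s \<in> {t k..<t (Suc k)} \<Longrightarrow> \<exists>u' w'.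
        (u k has_real_derivative u') (at s within {t k..<t (Suc k)}) \<and>
        (w k has_real_derivative w') (at s within {t k..<t (Suc k)}) \<and>
        u' \<le> - l * u k s + K * w k s \<and> w' \<le> - (f / \<epsilon>) * w k s + K * u k s"
    and nonneg: "\<And>k s. 0 \<le> u k s" "\<And>k s. 0 \<le> w k s"
    and lim: "\<And>k. (u k \<longlongrightarrow> um k) (at_left (t (Suc k)))" "\<And>k. (w k \<longlongrightarrow> wm k) (at_left (t (Suc k)))"
    and jump: "\<And>k. u (Suc k) (t (Suc k)) \<le> g * um k + M * wm k"
      "\<And>k. w (Suc k) (t (Suc k)) \<le> M * (um k + wm k)"
    and pos: "0 < \<epsilon>" "0 < f" "0 < K" "0 \<le> g" "0 < M" "0 < \<mu>" "0 < q"
    and e: "e = \<epsilon> * K / f" "e * K \<le> l" "e \<le> 1"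
    and E: "\<And>k. exp (- (f / \<epsilon>) * (t (Suc k) - t k)) \<le> E"
    and contr: "\<And>a b. \<lbrakk>0 \<le> a; 0 \<le> b\<rbrakk> \<Longrightarrow>
       (g + \<mu> * M) * (a + e * b) + (M + \<mu> * M) * (E * b + e * (a + e * b)) \<le> q * (a + \<mu> * b)"
    and s: "s \<in> {t k..<t (Suc k)}"
  shows "u k s + w k s \<le> 3 * (1 + 1 / \<mu>) * (1 + \<mu>) * q ^ k * (u 0 (t 0) + w 0 (t 0))"
proof -
  have e0: "0 \<le> e" using pos e by simp
  define a b where "a k = u k (t k)" and "b k = w k (t k)" for k
  have ab: "0 \<le> a k" "0 \<le> b k" for k using nonneg by (auto simp: a_def b_def)
  have flow: "u k s \<le> a k + e * b k"
      "w k s \<le> exp (- (f / \<epsilon>) * (s - t k)) * b k + e * (a k + e * b k)"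
    if "s \<in> {t k..<t (Suc k)}" for k s
    unfolding a_def b_def
    using two_time_scale_flow[OF D nonneg pos(1-3) e(1,2) that] by blast+
  have step: "a (Suc k) + \<mu> * b (Suc k) \<le> q * (a k + \<mu> * b k)" for k
  proof -
    have lt: "t k < t (Suc k)" using t by (simp add: strict_mono_def)
    \<comment> \<open>The flow estimates hold only on the half-open interval; they pass to the state
      just before the next event by taking left limits.\<close>
    have ev: "eventually (\<lambda>s. s \<in> {t k..<t (Suc k)}) (at_left (t (Suc k)))"
      unfolding eventually_at_left_field using lt by (intro exI[of _ "t k"]) auto
    have um: "um k \<le> a k + e * b k"
      by (rule tendsto_upperbound[OF lim(1) eventually_mono[OF ev]]) (use flow in auto)
    have "wm k \<le> exp (- (f / \<epsilon>) * (t (Suc k) - t k)) * b k + e * (a k + e * b k)"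
    proof (rule tendsto_le[OF _ _ lim(2) eventually_mono[OF ev]])
      show "((\<lambda>s. exp (- (f / \<epsilon>) * (s - t k)) * b k + e * (a k + e * b k)) \<longlongrightarrow>
          exp (- (f / \<epsilon>) * (t (Suc k) - t k)) * b k + e * (a k + e * b k)) (at_left (t (Suc k)))"
        by (intro tendsto_intros)
    qed (use flow in auto)
    also have "\<dots> \<le> E * b k + e * (a k + e * b k)"
      using E ab by (simp add: mult_right_mono)
    finally have wm: "wm k \<le> E * b k + e * (a k + e * b k)" .
    have "a (Suc k) + \<mu> * b (Suc k) \<le> (g * um k + M * wm k) + \<mu> * (M * (um k + wm k))"
      unfolding a_def b_def using jump pos by (intro add_mono mult_left_mono) auto
    also have "\<dots> = (g + \<mu> * M) * um k + (M + \<mu> * M) * wm k" by (simp add: algebra_simps)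
    also have "\<dots> \<le> (g + \<mu> * M) * (a k + e * b k) + (M + \<mu> * M) * (E * b k + e * (a k + e * b k))"
      using pos um wm by (intro add_mono mult_left_mono) auto
    also have "\<dots> \<le> q * (a k + \<mu> * b k)" by (rule contr[OF ab])
    finally show ?thesis .
  qed
  have iter: "a k + \<mu> * b k \<le> q ^ k * (a 0 + \<mu> * b 0)"
  proof (induction k)
    case (Suc k)
    have "q * (a k + \<mu> * b k) \<le> q * (q ^ k * (a 0 + \<mu> * b 0))"
      using Suc pos by (intro mult_left_mono) auto
    thus ?case using step[of k] by (simp add: mult.assoc)
  qed simp
  \<comment> \<open>Crude bounds within one interval: with \<open>e\<close> and the exponential at
    most 1, \<open>u\<close> is at most \<open>a k + b k\<close> and \<open>w\<close> at most
    \<open>a k + 2 * b k\<close>, which gives the factor 3.\<close>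
  have U: "a k + e * b k \<le> a k + b k" using e(3) e0 ab[of k] by (simp add: mult_left_le_one_le)
  have "exp (- (f / \<epsilon>) * (s - t k)) \<le> 1" using s pos by simp
  hence "exp (- (f / \<epsilon>) * (s - t k)) * b k \<le> b k" using ab by (simp add: mult_left_le_one_le)
  moreover have "e * (a k + e * b k) \<le> a k + e * b k"
    using e(3) e0 ab[of k] by (intro mult_left_le_one_le) auto
  ultimately have "w k s \<le> b k + (a k + e * b k)"
    by (intro order_trans[OF flow(2)[OF s]] add_mono)
  hence "u k s + w k s \<le> (a k + b k) + (b k + (a k + b k))"
    using flow(1)[OF s] U by (meson add_mono order_refl order_trans)
  hence "u k s + w k s \<le> 3 * (a k + b k)"
    using ab[of k] by simp
  \<comment> \<open>The contraction concerns \<open>a + \<mu> * b\<close>, so \<open>a + b\<close>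
    is compared with it here at index \<open>k\<close>, and below in the other direction at index
    0.\<close>
  also have "\<dots> \<le> 3 * ((1 + 1 / \<mu>) * (a k + \<mu> * b k))"
    using ab[of k] pos by (simp add: field_simps)
  also have "\<dots> \<le> 3 * ((1 + 1 / \<mu>) * (q ^ k * (a 0 + \<mu> * b 0)))"
    using iter pos by (intro mult_left_mono) auto
  also have "\<dots> \<le> 3 * ((1 + 1 / \<mu>) * (q ^ k * ((1 + \<mu>) * (a 0 + b 0))))"
    using ab[of 0] pos by (intro mult_left_mono) (auto simp: algebra_simps)
  finally show ?thesis unfolding a_def b_def by (simp only: mult_ac)
qed

section \<open>From geometric decay along events to asymptotic stability\<close>

lemma event_times_interval:
  assumes t: "event_times t" "t K \<le> s"
  obtains k where "K \<le> k" "s \<in> {t k..<t (Suc k)}"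
proof -
  have mono: "strict_mono t" using t(1) by (simp add: event_times_def)
  have ex: "\<exists>n. s < t n" using t(1) unfolding event_times_def bdd_above_def
    by (metis linorder_not_less rangeE)
  define n where "n = (LEAST n. s < t n)"
  have n: "s < t n" unfolding n_def using ex by (rule LeastI_ex)
  have "K < n" using n t(2) mono by (metis le_less_trans strict_mono_less)
  then obtain k where k: "n = Suc k" "K \<le> k" by (metis less_Suc_eq_le old.nat.exhaust not_less0)
  have "\<not> s < t k" using not_less_Least[of k "\<lambda>n. s < t n"] k by (simp add: n_def)
  thus ?thesis using that n k by auto
qed

text \<open>The decay is counted in events, not in time, because gaps between events have no upper
  bound. This is enough: every time from \<open>t K\<close> on lies in an interval of index at least
  \<open>K\<close>. Stability is the case \<open>K = 0\<close>, attraction the case of large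
  \<open>K\<close>.\<close>

lemma globally_asymptotically_stableI:
  fixes sol :: "(real \<Rightarrow> real^'nx) \<Rightarrow> (real \<Rightarrow> real^'nz) \<Rightarrow> bool"
  assumes t: "event_times t" and q: "0 < q" "q < 1" and C: "0 < C"
    and est: "\<And>x y k s. \<lbrakk>sol x y; s \<in> {t k..<t (Suc k)}\<rbrakk> \<Longrightarrow>
        (norm (x s, y s))\<^sup>2 \<le> C * q ^ k * (norm (x 0, y 0))\<^sup>2"
  shows "globally_asymptotically_stable sol"
proof -
  have t0: "t 0 = 0" using t by (simp add: event_times_def)
  have bound: "(norm (x s, y s))\<^sup>2 \<le> C * q ^ K * (norm (x 0, y 0))\<^sup>2"
    if xy: "sol x y" and s: "t K \<le> s" for x y K s
  proof -
    obtain k where k: "K \<le> k" "s \<in> {t k..<t (Suc k)}" using event_times_interval[OF t s] .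
    have "q ^ k \<le> q ^ K" using k q by (intro power_decreasing) auto
    hence "C * q ^ k * (norm (x 0, y 0))\<^sup>2 \<le> C * q ^ K * (norm (x 0, y 0))\<^sup>2"
      using C by (intro mult_right_mono mult_left_mono) auto
    thus ?thesis using est[OF xy k(2)] by linarith
  qed
  have stab: "\<exists>\<delta>>0. \<forall>x y. sol x y \<and> norm (x 0, y 0) < \<delta> \<longrightarrow> (\<forall>s\<ge>0. norm (x s, y s) < \<rho>)"
    if "\<rho> > 0" for \<rho>
  proof (intro exI[of _ "\<rho> / sqrt C"] conjI allI impI)
    show "\<rho> / sqrt C > 0" using that C by simp
    fix x y s assume xy: "sol x y \<and> norm (x 0, y 0) < \<rho> / sqrt C" and s: "(0::real) \<le> s"
    have "(norm (x 0, y 0))\<^sup>2 < (\<rho> / sqrt C)\<^sup>2" using xy by (intro power_strict_mono) auto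
    hence "C * (norm (x 0, y 0))\<^sup>2 < \<rho>\<^sup>2" using C by (simp add: power_divide field_simps)
    hence "(norm (x s, y s))\<^sup>2 < \<rho>\<^sup>2" using bound[of x y 0 s] xy s t0 by simp
    thus "norm (x s, y s) < \<rho>" using that power_less_imp_less_base less_imp_le by blast
  qed
  have attr: "((\<lambda>s. (x s, y s)) \<longlongrightarrow> 0) at_top" if sol: "sol x y" for x y
  proof (rule tendstoI)
    fix r :: real assume r: "r > 0"
    have "(\<lambda>k. C * q ^ k * (norm (x 0, y 0))\<^sup>2) \<longlonglongrightarrow> C * 0 * (norm (x 0, y 0))\<^sup>2"
      using q by (intro tendsto_intros LIMSEQ_power_zero) auto
    hence "eventually (\<lambda>k. C * q ^ k * (norm (x 0, y 0))\<^sup>2 < r\<^sup>2) sequentially"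
      using r by (intro order_tendstoD(2)) auto
    then obtain K where K: "C * q ^ K * (norm (x 0, y 0))\<^sup>2 < r\<^sup>2"
      using eventually_happens'[OF sequentially_bot] by blast
    have "dist (x s, y s) 0 < r" if "t K \<le> s" for s
    proof -
      have "(norm (x s, y s))\<^sup>2 < r\<^sup>2" using bound[OF sol that] K by linarith
      thus ?thesis using r power_less_imp_less_base[of "norm (x s, y s)" 2 r] by simp
    qed
    thus "eventually (\<lambda>s. dist (x s, y s) 0 < r) at_top"
      by (rule eventually_at_top_linorderI)
  qed
  show ?thesis unfolding globally_asymptotically_stable_def using stab attr by blast
qed

subsection \<open>Quadratic forms along flow and jumps\<close>

lemma block_vec_eq_iff:
  fixes x :: "real^'nx::finite" and y :: "real^'nz::finite"
  shows "block_vec x y = block_vec x' y' \<longleftrightarrow> x = x' \<and> y = y'"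
  by (auto simp: vec_eq_iff block_vec_def split: sum.split dest: spec[of _ "Inl _"] spec[of _ "Inr _"])

lemma matrix_mult_block_vec:
  fixes M :: "real^('nx::finite + 'nz::finite)^('nx + 'nz)"
  shows "M *v block_vec x y = block_vec (blk11 M *v x + blk12 M *v y) (blk21 M *v x + blk22 M *v y)"
proof -
  have "(\<Sum>c\<in>UNIV. h c) = (\<Sum>a\<in>UNIV. h (Inl a)) + (\<Sum>b\<in>UNIV. h (Inr b))"
    for h :: "'nx + 'nz \<Rightarrow> real"
    using sum.Plus[of UNIV UNIV h] by simp
  thus ?thesis
    by (simp add: vec_eq_iff block_vec_def matrix_vector_mult_def blk11_def blk12_def blk21_def
        blk22_def split: sum.split)
qed

section \<open>Inequalities between quadratic forms\<close>

lemma mat_1_le_quadratic: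
  assumes "loewner_le (mat 1) Q"
  shows "x \<bullet> x \<le> x \<bullet> (Q *v x)"
  using assms by (auto simp: loewner_le_def pos_semidef_def matrix_vector_mult_diff_rdistrib inner_diff_right)

lemma symmetric_matrix_inner_commute:
  assumes "symmetric_matrix Q"
  shows "x \<bullet> (Q *v y) = y \<bullet> (Q *v x)"
  by (metis assms symmetric_matrix_inner inner_commute)

lemma lyapunov_quadratic:
  assumes sym: "symmetric_matrix Q"
    and lyap: "loewner_le (transpose A ** Q + Q ** A) ((- 2 * l) *\<^sub>R Q)"
  shows "2 * (x \<bullet> (Q *v (A *v x))) \<le> - 2 * l * (x \<bullet> (Q *v x))"
proof -
  have "x \<bullet> ((transpose A ** Q + Q ** A) *v x) \<le> x \<bullet> (((- 2 * l) *\<^sub>R Q) *v x)"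
    using lyap by (auto simp: loewner_le_def pos_semidef_def matrix_vector_mult_diff_rdistrib inner_diff_right)
  moreover have "x \<bullet> ((transpose A ** Q) *v x) = x \<bullet> (Q *v (A *v x))"
  proof -
    have "x \<bullet> ((transpose A ** Q) *v x) = x \<bullet> (transpose A *v (Q *v x))"
      by (simp only: matrix_vector_mul_assoc)
    also have "\<dots> = (Q *v x) \<bullet> (A *v x)"
      by (simp add: inner_commute[of x] dot_lmul_matrix)
    also have "\<dots> = x \<bullet> (Q *v (A *v x))" by (rule symmetric_matrix_inner[OF sym])
    finally show ?thesis .
  qed
  moreover have "x \<bullet> (((- 2 * l) *\<^sub>R Q) *v x) = - 2 * l * (x \<bullet> (Q *v x))"
    by (simp only: scaleR_matrix_vector_assoc[symmetric] inner_scaleR_right)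
  moreover have "x \<bullet> ((Q ** A) *v x) = x \<bullet> (Q *v (A *v x))" by (simp only: matrix_vector_mul_assoc)
  ultimately show ?thesis
    by (simp only: matrix_vector_mult_add_rdistrib inner_add_right)
qed

text \<open>Young's inequality, from the square of \<open>l *\<^sub>R x - M *v y\<close>. The
  constant is left as "all large \<open>K\<close>" so that finitely many such bounds, over modes and
  jumps, can later be met by one constant.\<close>

lemma cross_term_bound:
  fixes M :: "real^'n^'m"
  assumes "0 < l"
  shows "\<forall>\<^sub>F K in at_top. \<forall>x y. 2 * (x \<bullet> (M *v y)) \<le> l * (x \<bullet> x) + K * (y \<bullet> y)"
proof (rule eventually_at_top_linorderI, intro allI)
  fix K x y assume K: "(onorm ((*v) M))\<^sup>2 / l \<le> K"
  have "0 \<le> (l *\<^sub>R x - M *v y) \<bullet> (l *\<^sub>R x - M *v y)" by simp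
  also have "\<dots> = l * (l * (x \<bullet> x) - 2 * (x \<bullet> (M *v y))) + (norm (M *v y))\<^sup>2"
    by (simp add: inner_diff_left inner_diff_right inner_commute[of "M *v y" x]
        power2_norm_eq_inner right_diff_distrib)
  finally have "l * (2 * (x \<bullet> (M *v y))) \<le> l * (l * (x \<bullet> x)) + (norm (M *v y))\<^sup>2"
    by (simp add: right_diff_distrib)
  also have "(norm (M *v y))\<^sup>2 \<le> (onorm ((*v) M) * norm y)\<^sup>2"
    by (intro power_mono onorm) auto
  also have "\<dots> = l * ((onorm ((*v) M))\<^sup>2 / l * (y \<bullet> y))"
    using assms by (simp add: power_mult_distrib power2_norm_eq_inner)
  also have "\<dots> \<le> l * (K * (y \<bullet> y))"
    using assms K by (intro mult_left_mono mult_right_mono) auto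
  finally have "l * (2 * (x \<bullet> (M *v y))) \<le> l * (l * (x \<bullet> x) + K * (y \<bullet> y))"
    by (simp add: distrib_left)
  thus "2 * (x \<bullet> (M *v y)) \<le> l * (x \<bullet> x) + K * (y \<bullet> y)"
    using assms mult_le_cancel_left_pos by blast
qed

text \<open>Besides bounding the fast form after a jump, this serves with \<open>0\<close> or
  \<open>mat 1\<close> for \<open>G\<close> or \<open>H\<close> to bound a form by the squared norm
  of a single vector.\<close>

lemma quadratic_form_bound:
  fixes Q :: "real^'n^'n" and G :: "real^'k^'n" and H :: "real^'m^'n"
  shows "\<forall>\<^sub>F K in at_top. \<forall>x y. (G *v x + H *v y) \<bullet> (Q *v (G *v x + H *v y)) \<le> K * (x \<bullet> x + y \<bullet> y)"
proof -
  define q g h where "q = onorm ((*v) Q)" and "g = onorm ((*v) G)" and "h = onorm ((*v) H)"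
  have nn: "0 \<le> q" "0 \<le> g" "0 \<le> h" by (auto simp: q_def g_def h_def onorm_pos_le)
  show ?thesis
  proof (rule eventually_at_top_linorderI[of "q * (2 * g\<^sup>2 + 2 * h\<^sup>2)"], intro allI)
    fix K x y assume K: "q * (2 * g\<^sup>2 + 2 * h\<^sup>2) \<le> K"
    define z where "z = G *v x + H *v y"
    have "norm z \<le> norm (G *v x) + norm (H *v y)" unfolding z_def by (rule norm_triangle_ineq)
    also have "\<dots> \<le> g * norm x + h * norm y"
      unfolding g_def h_def by (intro add_mono onorm) auto
    finally have "(norm z)\<^sup>2 \<le> (g * norm x + h * norm y)\<^sup>2" by (intro power_mono) auto
    also have "\<dots> \<le> 2 * (g * norm x)\<^sup>2 + 2 * (h * norm y)\<^sup>2"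
      using sum_squares_bound[of "g * norm x" "h * norm y"] by (simp add: power2_sum)
    also have "\<dots> = 2 * g\<^sup>2 * (x \<bullet> x) + 2 * h\<^sup>2 * (y \<bullet> y)"
      by (simp add: power_mult_distrib power2_norm_eq_inner)
    also have "\<dots> \<le> (2 * g\<^sup>2 + 2 * h\<^sup>2) * (x \<bullet> x + y \<bullet> y)"
      by (simp add: algebra_simps)
    finally have z: "(norm z)\<^sup>2 \<le> (2 * g\<^sup>2 + 2 * h\<^sup>2) * (x \<bullet> x + y \<bullet> y)" .
    have "z \<bullet> (Q *v z) \<le> norm z * norm (Q *v z)" by (rule norm_cauchy_schwarz)
    also have "\<dots> \<le> norm z * (q * norm z)"
      unfolding q_def by (intro mult_left_mono onorm) auto
    also have "\<dots> = q * (norm z)\<^sup>2" by (simp add: power2_eq_square)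
    also have "\<dots> \<le> q * ((2 * g\<^sup>2 + 2 * h\<^sup>2) * (x \<bullet> x + y \<bullet> y))"
      using z nn(1) by (rule mult_left_mono)
    also have "\<dots> \<le> K * (x \<bullet> x + y \<bullet> y)"
      unfolding mult.assoc[symmetric] using K by (intro mult_right_mono) auto
    finally show "(G *v x + H *v y) \<bullet> (Q *v (G *v x + H *v y)) \<le> K * (x \<bullet> x + y \<bullet> y)"
      unfolding z_def .
  qed
qed

text \<open>Half of the decay rate \<open>2 * l\<close> is given up to absorb the cross term with
  \<open>y\<close>; the bounds \<open>mat 1\<close> below \<open>Q\<close> and \<open>Q'\<close>
  turn squared norms into quadratic forms.\<close>

lemma slow_lyapunov_decay:
  assumes Q: "symmetric_matrix Q" "loewner_le (mat 1) Q" and l: "0 < l"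
    and lyap: "loewner_le (transpose A ** Q + Q ** A) ((- 2 * l) *\<^sub>R Q)"
    and Q': "loewner_le (mat 1) Q'"
  shows "\<forall>\<^sub>F K in at_top. \<forall>x y. 2 * (x \<bullet> (Q *v (A *v x + B *v y)))
      \<le> - l * (x \<bullet> (Q *v x)) + K * (y \<bullet> (Q' *v y))"
  using cross_term_bound[OF l, of "Q ** B"] eventually_ge_at_top[of 0]
proof eventually_elim
  case (elim K)
  show ?case
  proof (intro allI)
    fix x y
    have "2 * (x \<bullet> (Q *v (A *v x + B *v y))) = 2 * (x \<bullet> (Q *v (A *v x))) + 2 * (x \<bullet> ((Q ** B) *v y))"
      by (simp add: matrix_vector_right_distrib inner_add_right matrix_vector_mul_assoc[symmetric])
    also have "\<dots> \<le> - 2 * l * (x \<bullet> (Q *v x)) + (l * (x \<bullet> x) + K * (y \<bullet> y))"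
      using lyapunov_quadratic[OF Q(1) lyap] elim(1) by (intro add_mono) auto
    also have "\<dots> \<le> - 2 * l * (x \<bullet> (Q *v x)) + (l * (x \<bullet> (Q *v x)) + K * (y \<bullet> (Q' *v y)))"
      using mat_1_le_quadratic[OF Q(2), of x] mat_1_le_quadratic[OF Q', of y] l elim(2)
      by (intro add_left_mono, intro add_mono mult_left_mono) auto
    finally show "2 * (x \<bullet> (Q *v (A *v x + B *v y))) \<le> - l * (x \<bullet> (Q *v x)) + K * (y \<bullet> (Q' *v y))"
      by simp
  qed
qed

text \<open>This concerns the part of \<open>y'\<close> that carries no factor
  \<open>1 / \<epsilon>\<close>. It has no sign, and its size is all that matters against the fast
  decay.\<close>

lemma fast_lyapunov_perturbation:
  assumes Q: "loewner_le (mat 1) Q" and Q': "loewner_le (mat 1) Q'"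
  shows "\<forall>\<^sub>F K in at_top. \<forall>x y. 2 * (y \<bullet> (Q *v (B *v x + C *v y)))
      \<le> K * (x \<bullet> (Q' *v x)) + K * (y \<bullet> (Q *v y))"
proof -
  have "\<forall>\<^sub>F K in at_top. (\<forall>y x. 2 * (y \<bullet> ((Q ** B) *v x)) \<le> 1 * (y \<bullet> y) + K * (x \<bullet> x)) \<and>
      (\<forall>y z. 2 * (y \<bullet> ((Q ** C) *v z)) \<le> 1 * (y \<bullet> y) + K * (z \<bullet> z)) \<and> 0 \<le> K"
    by (intro eventually_conj cross_term_bound eventually_ge_at_top) auto
  then obtain K where K: "\<And>x y. 2 * (y \<bullet> ((Q ** B) *v x)) \<le> 1 * (y \<bullet> y) + K * (x \<bullet> x)"
      "\<And>y z. 2 * (y \<bullet> ((Q ** C) *v z)) \<le> 1 * (y \<bullet> y) + K * (z \<bullet> z)" "0 \<le> K"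
    using eventually_happens' trivial_limit_at_top_linorder by blast
  show ?thesis
  \<comment> \<open>Each of the two Young inequalities contributes one \<open>y \<bullet> y\<close>,
    and the one for \<open>C\<close> a further \<open>K * (y \<bullet> y)\<close>.\<close>
  proof (rule eventually_at_top_linorderI[of "K + 2"], intro allI)
    fix L x y assume L: "K + 2 \<le> L"
    have "2 * (y \<bullet> (Q *v (B *v x + C *v y))) = 2 * (y \<bullet> ((Q ** B) *v x)) + 2 * (y \<bullet> ((Q ** C) *v y))"
      by (simp add: matrix_vector_right_distrib inner_add_right matrix_vector_mul_assoc[symmetric])
    also have "\<dots> \<le> K * (x \<bullet> x) + (K + 2) * (y \<bullet> y)"
      using K(1)[of y x] K(2)[of y y] by (simp add: algebra_simps)
    also have "\<dots> \<le> L * (x \<bullet> (Q' *v x)) + L * (y \<bullet> (Q *v y))"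
      using L K(3) mat_1_le_quadratic[OF Q, of y] mat_1_le_quadratic[OF Q', of x]
      by (intro add_mono mult_mono) auto
    finally show "2 * (y \<bullet> (Q *v (B *v x + C *v y))) \<le> L * (x \<bullet> (Q' *v x)) + L * (y \<bullet> (Q *v y))" .
  qed
qed

section \<open>Square-root weights and contraction at jumps\<close>

lemma matrix_inv_mult_left:
  assumes "invertible A"
  shows "matrix_inv A ** A = mat 1"
  using someI_ex[of "\<lambda>A'. A ** A' = mat 1 \<and> A' ** A = mat 1"] assms
  unfolding matrix_inv_def invertible_def by blast

lemma matrix_sqrt_norm:
  assumes Q: "symmetric_matrix Q" "loewner_le (mat 1) Q"
  shows "(norm (matrix_sqrt Q *v x))\<^sup>2 = x \<bullet> (Q *v x)" and "invertible (matrix_sqrt Q)"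
proof -
  have pos: "0 < v \<bullet> (Q *v v)" if "v \<noteq> 0" for v
    using that mat_1_le_quadratic[OF Q(2), of v] by (metis inner_gt_zero_iff less_le_trans)
  note T = matrix_sqrt_pos_def[OF Q(1) pos]
  have sym: "symmetric_matrix (matrix_sqrt Q)" using T(1) by (simp add: pos_semidef_def)
  show N: "(norm (matrix_sqrt Q *v x))\<^sup>2 = x \<bullet> (Q *v x)" for x
    by (simp add: power2_norm_eq_inner symmetric_matrix_inner[OF sym] matrix_vector_mul_assoc T(2))
  have "x = 0" if "matrix_sqrt Q *v x = 0" for x
    using N[of x] pos[of x] that by fastforce
  thus "invertible (matrix_sqrt Q)"
    using invertible_left_inverse matrix_left_invertible_ker by blast
qed

text \<open>Substituting \<open>matrix_sqrt Q *v x\<close> for the argument cancels the inverse root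
  and turns Euclidean norms into the weighted forms. This is how \<open>gamma11\<close> enters the
  Lyapunov estimate.\<close>

lemma spectral_norm_weighted:
  fixes G :: "real^'n^'m"
  assumes Q: "symmetric_matrix Q" "loewner_le (mat 1) Q"
    and Q': "symmetric_matrix Q'" "loewner_le (mat 1) Q'"
    and le: "spectral_norm (matrix_sqrt Q' ** G ** matrix_inv (matrix_sqrt Q)) \<le> \<gamma>"
  shows "(G *v x) \<bullet> (Q' *v (G *v x)) \<le> \<gamma>\<^sup>2 * (x \<bullet> (Q *v x))"
proof -
  let ?T = "matrix_sqrt Q" and ?T' = "matrix_sqrt Q'"
  let ?N = "?T' ** G ** matrix_inv ?T"
  have "norm (?N *v (?T *v x)) \<le> spectral_norm ?N * norm (?T *v x)"
    unfolding spectral_norm_def by (rule onorm) simp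
  also have "\<dots> \<le> \<gamma> * norm (?T *v x)" by (intro mult_right_mono le) simp
  also have "?N *v (?T *v x) = ?T' *v (G *v x)"
    using matrix_inv_mult_left[OF matrix_sqrt_norm(2)[OF Q]]
    by (simp add: matrix_vector_mul_assoc matrix_mul_assoc[symmetric])
  finally have "(norm (?T' *v (G *v x)))\<^sup>2 \<le> (\<gamma> * norm (?T *v x))\<^sup>2"
    by (intro power_mono) auto
  thus ?thesis by (simp add: power_mult_distrib matrix_sqrt_norm(1)[OF Q] matrix_sqrt_norm(1)[OF Q'])
qed

text \<open>Half of the gap \<open>1 - \<gamma>\<^sup>2\<close> pays for the cross term between
  \<open>G *v x\<close> and \<open>H *v y\<close>: Young's inequality with weight \<theta> gives the
  factor \<open>(1 + \<theta>) * \<gamma>\<^sup>2\<close>, at most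
  \<open>\<gamma>\<^sup>2 + \<theta> = (1 + \<gamma>\<^sup>2) / 2\<close>.\<close>

lemma contractive_jump_perturbation:
  fixes G :: "real^'n^'m" and H :: "real^'k^'m"
  assumes Q': "symmetric_matrix Q'" "loewner_le (mat 1) Q'" and Q: "loewner_le (mat 1) Q"
    and \<gamma>: "0 \<le> \<gamma>" "\<gamma> < 1"
    and G: "\<And>x. (G *v x) \<bullet> (Q' *v (G *v x)) \<le> \<gamma>\<^sup>2 * (x \<bullet> (Q *v x))"
  shows "\<forall>\<^sub>F K in at_top. \<forall>x y. (G *v x + H *v y) \<bullet> (Q' *v (G *v x + H *v y))
      \<le> (1 + \<gamma>\<^sup>2) / 2 * (x \<bullet> (Q *v x)) + K * (y \<bullet> y)"
proof -
  define \<theta> where "\<theta> = (1 - \<gamma>\<^sup>2) / 2"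
  have \<gamma>2: "0 \<le> \<gamma>\<^sup>2" "\<gamma>\<^sup>2 < 1" using \<gamma> by (auto simp: power_less_one_iff)
  hence \<theta>: "0 < \<theta>" by (simp add: \<theta>_def)
  have "\<theta> * \<gamma>\<^sup>2 \<le> \<theta>" using \<gamma>2 \<theta> by (simp add: mult_left_le)
  hence coeff: "(1 + \<theta>) * \<gamma>\<^sup>2 \<le> (1 + \<gamma>\<^sup>2) / 2"
    by (simp add: distrib_right \<theta>_def field_simps)
  have "\<forall>\<^sub>F K in at_top. (\<forall>z y. 2 * (z \<bullet> ((Q' ** H) *v y)) \<le> \<theta> * (z \<bullet> z) + K * (y \<bullet> y)) \<and>
      (\<forall>(x :: real^'m) y. (0 *v x + H *v y) \<bullet> (Q' *v (0 *v x + H *v y)) \<le> K * (x \<bullet> x + y \<bullet> y))"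
    by (intro eventually_conj cross_term_bound quadratic_form_bound \<theta>)
  \<comment> \<open>The second bound comes from \<open>quadratic_form_bound\<close> with zero matrix
    for \<open>G\<close>; its vector \<open>x\<close> is a dummy, set to 0 below.\<close>
  then obtain K where K: "\<And>z y. 2 * (z \<bullet> ((Q' ** H) *v y)) \<le> \<theta> * (z \<bullet> z) + K * (y \<bullet> y)"
      "\<And>(x :: real^'m) y. (0 *v x + H *v y) \<bullet> (Q' *v (0 *v x + H *v y)) \<le> K * (x \<bullet> x + y \<bullet> y)"
    using eventually_happens' trivial_limit_at_top_linorder by blast
  show ?thesis
  proof (rule eventually_at_top_linorderI[of "2 * K"], intro allI)
    fix L x y assume L: "2 * K \<le> L"
    let ?a = "G *v x" and ?b = "H *v y"
    have "(?a + ?b) \<bullet> (Q' *v (?a + ?b)) = ?a \<bullet> (Q' *v ?a) + 2 * (?a \<bullet> ((Q' ** H) *v y)) + ?b \<bullet> (Q' *v ?b)"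
      using symmetric_matrix_inner_commute[OF Q'(1), of ?b ?a]
      by (simp add: matrix_vector_right_distrib inner_add_left inner_add_right matrix_vector_mul_assoc[symmetric])
    also have "\<dots> \<le> ?a \<bullet> (Q' *v ?a) + (\<theta> * (?a \<bullet> (Q' *v ?a)) + K * (y \<bullet> y)) + K * (y \<bullet> y)"
    proof (intro add_mono order_refl)
      show "2 * (?a \<bullet> ((Q' ** H) *v y)) \<le> \<theta> * (?a \<bullet> (Q' *v ?a)) + K * (y \<bullet> y)"
        using K(1)[of ?a y] mult_left_mono[OF mat_1_le_quadratic[OF Q'(2), of ?a], of \<theta>] \<theta> by linarith
      show "?b \<bullet> (Q' *v ?b) \<le> K * (y \<bullet> y)" using K(2)[of 0 y] by simp
    qed
    also have "\<dots> = (1 + \<theta>) * (?a \<bullet> (Q' *v ?a)) + (2 * K) * (y \<bullet> y)" by (simp add: algebra_simps)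
    also have "\<dots> \<le> (1 + \<theta>) * (\<gamma>\<^sup>2 * (x \<bullet> (Q *v x))) + L * (y \<bullet> y)"
      using \<theta> L by (intro add_mono mult_left_mono mult_right_mono G) auto
    also have "\<dots> = ((1 + \<theta>) * \<gamma>\<^sup>2) * (x \<bullet> (Q *v x)) + L * (y \<bullet> y)" by simp
    also have "\<dots> \<le> (1 + \<gamma>\<^sup>2) / 2 * (x \<bullet> (Q *v x)) + L * (y \<bullet> y)"
      using order_trans[OF inner_ge_zero mat_1_le_quadratic[OF Q, of x]]
      by (intro add_right_mono mult_right_mono coeff)
    finally show "(?a + ?b) \<bullet> (Q' *v (?a + ?b)) \<le> (1 + \<gamma>\<^sup>2) / 2 * (x \<bullet> (Q *v x)) + L * (y \<bullet> y)" .
  qed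
qed

lemma quadratic_form_has_derivative:
  assumes Q: "symmetric_matrix Q" and x: "(x has_vector_derivative x') (at s within S)"
  shows "((\<lambda>s. x s \<bullet> (Q *v x s)) has_real_derivative 2 * (x s \<bullet> (Q *v x'))) (at s within S)"
proof -
  have "((\<lambda>s. Q *v x s) has_vector_derivative Q *v x') (at s within S)"
    by (rule bounded_linear.has_vector_derivative[OF matrix_vector_mul_bounded_linear x])
  from bounded_bilinear.has_vector_derivative[OF bounded_bilinear_inner x this]
  show ?thesis
    unfolding has_real_derivative_iff_has_vector_derivative
    using symmetric_matrix_inner_commute[OF Q, of "x s" x'] by simp
qed

text \<open>Of the decay \<open>2 * l\<close>, at least \<open>2 * f\<close>, the perturbation takes
  up to \<open>K * \<epsilon> \<le> f\<close>, so \<open>f\<close> remains. The computation is done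
  for \<open>\<epsilon> *\<^sub>R y'\<close>, the form in which the system is given, and divided by
  \<epsilon> at the end.\<close>

lemma fast_lyapunov_decay:
  assumes Q: "symmetric_matrix Q" "loewner_le (mat 1) Q"
    and lyap: "loewner_le (transpose A ** Q + Q ** A) ((- 2 * l) *\<^sub>R Q)"
    and \<epsilon>: "0 < \<epsilon>" "f \<le> l" "K * \<epsilon> \<le> f"
    and pert: "2 * (y \<bullet> (Q *v (b + C *v y))) \<le> K * U + K * (y \<bullet> (Q *v y))"
    and y': "\<epsilon> *\<^sub>R y' = \<epsilon> *\<^sub>R b + (A + \<epsilon> *\<^sub>R C) *v y"
  shows "2 * (y \<bullet> (Q *v y')) \<le> - (f / \<epsilon>) * (y \<bullet> (Q *v y)) + K * U"
proof -
  let ?W = "y \<bullet> (Q *v y)"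
  have W: "0 \<le> ?W" by (rule order_trans[OF inner_ge_zero mat_1_le_quadratic[OF Q(2)]])
  have "\<epsilon> *\<^sub>R y' = \<epsilon> *\<^sub>R (b + C *v y) + A *v y"
    unfolding y' by (simp add: matrix_vector_mult_add_rdistrib scaleR_matrix_vector_assoc[symmetric] scaleR_add_right)
  hence "2 * (y \<bullet> (Q *v (\<epsilon> *\<^sub>R y'))) = \<epsilon> * (2 * (y \<bullet> (Q *v (b + C *v y)))) + 2 * (y \<bullet> (Q *v (A *v y)))"
    by (simp only: matrix_vector_right_distrib inner_add_right matrix_vector_mult_scaleR inner_scaleR_right
       distrib_left mult_ac)
  also have "\<dots> \<le> \<epsilon> * (K * U + K * ?W) + - 2 * l * ?W"
    using pert \<epsilon> by (intro add_mono mult_left_mono lyapunov_quadratic[OF Q(1) lyap]) auto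
  also have "\<dots> = \<epsilon> * (K * U) + (K * \<epsilon>) * ?W - 2 * (l * ?W)" by (simp add: algebra_simps)
  also have "\<dots> \<le> \<epsilon> * (K * U) + f * ?W - 2 * (f * ?W)"
    using W \<epsilon> by (intro diff_mono add_left_mono mult_left_mono mult_right_mono) auto
  also have "\<dots> = \<epsilon> * (- (f / \<epsilon>) * ?W + K * U)" using \<epsilon> by (simp add: field_simps)
  finally have "\<epsilon> * (2 * (y \<bullet> (Q *v y'))) \<le> \<epsilon> * (- (f / \<epsilon>) * ?W + K * U)"
    by (simp only: matrix_vector_mult_scaleR inner_scaleR_right mult_ac)
  thus ?thesis using \<epsilon>(1) mult_le_cancel_left_pos by blast
qed

subsection \<open>Global asymptotic stability\<close>

theorem theorem11:
  fixes F :: "'i::finite \<Rightarrow> ('nx::finite + 'nz::finite) set"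
    and S bA :: "'i \<Rightarrow> real^('nx + 'nz)^('nx + 'nz)"
    and bJ :: "'j::finite \<Rightarrow> real^('nx + 'nz)^('nx + 'nz)"
    and Qs :: "'i \<Rightarrow> real^'nx^'nx" and Qf :: "'i \<Rightarrow> real^'nz^'nz"
    and lams lamf :: "'i \<Rightarrow> real"
  assumes F_card: "\<And>i. card (F i) = CARD('nz)"
    and S_perm: "\<And>i. permutation_matrix (S i)"
    and S_scale: "\<And>i \<epsilon>. \<epsilon> > 0 \<Longrightarrow>
          S i ** scale_mat (F i) \<epsilon> ** transpose (S i) = block_mat (mat 1) 0 0 (mat \<epsilon>)"
    and A22_inv: "\<And>i. invertible (blk22 (flow_mat S bA i))"
    and A0_hurwitz: "\<And>i. hurwitz (A0 (flow_mat S bA i))"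
    and A22_hurwitz: "\<And>i. hurwitz (blk22 (flow_mat S bA i))"
    and Qs_sym: "\<And>i. symmetric_matrix (Qs i)"
    and Qs_ge: "\<And>i. loewner_le (mat 1) (Qs i)"
    and Qf_sym: "\<And>i. symmetric_matrix (Qf i)"
    and Qf_ge: "\<And>i. loewner_le (mat 1) (Qf i)"
    and lams_pos: "\<And>i. lams i > 0"
    and lamf_pos: "\<And>i. lamf i > 0"
    and Qs_lyap: "\<And>i. loewner_le
          (transpose (A0 (flow_mat S bA i)) ** Qs i + Qs i ** A0 (flow_mat S bA i))
          ((- 2 * lams i) *\<^sub>R Qs i)"
    and Qf_lyap: "\<And>i. loewner_le
          (transpose (blk22 (flow_mat S bA i)) ** Qf i + Qf i ** blk22 (flow_mat S bA i))
          ((- 2 * lamf i) *\<^sub>R Qf i)"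
    and gamma11_lt: "gamma11 S bA bJ Qs < 1"
  shows "\<exists>\<epsilon>4>0. \<exists>\<eta>4 :: real \<Rightarrow> real.
           (\<forall>\<epsilon>\<in>{0<..<\<epsilon>4}. \<eta>4 \<epsilon> \<ge> 0) \<and>
           \<eta>4 \<in> O[at_right 0](\<lambda>\<epsilon>. \<epsilon>) \<and>
           (\<forall>\<epsilon>\<in>{0<..<\<epsilon>4}. \<forall>t \<sigma> \<nu>.
              event_times t \<and> (\<exists>\<tau>>\<eta>4 \<epsilon>. \<forall>k. t (Suc k) - t k \<ge> \<tau>) \<longrightarrow>
              globally_asymptotically_stable (hybrid_solution S bA bJ \<epsilon> t \<sigma> \<nu>))"
proof -

  \<comment> \<open>Constants uniform over modes and jumps\<close>
  define A where "A = flow_mat S bA"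
  define R where "R = R_mat S bA bJ"
  define \<gamma> where "\<gamma> = gamma11 S bA bJ Qs"
  have \<gamma>_ge: "spectral_norm (matrix_sqrt (Qs i') ** blk11 (R i j i') ** matrix_inv (matrix_sqrt (Qs i))) \<le> \<gamma>"
    for i j i'
    unfolding \<gamma>_def gamma11_def R_def by (rule Max_ge) (auto intro: rev_image_eqI[of "(i, j, i')"])
  have \<gamma>: "0 \<le> \<gamma>" "\<gamma> < 1"
    using order_trans[OF onorm_pos_le \<gamma>_ge[unfolded spectral_norm_def]] gamma11_lt
    by (auto simp: \<gamma>_def)
  define g where "g = (1 + \<gamma>\<^sup>2) / 2"
  have g: "0 \<le> g" "g < 1" using \<gamma> by (auto simp: g_def power_less_one_iff)
  define l where "l = Min (range lams)"
  define f where "f = Min (range lamf)"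
  have l: "0 < l" "\<And>i. l \<le> lams i" and f: "0 < f" "\<And>i. f \<le> lamf i"
    using lams_pos lamf_pos by (auto simp: l_def f_def)
  note Qs = Qs_sym Qs_ge and Qf = Qf_sym Qf_ge
  have Qs_inner: "x \<bullet> x \<le> x \<bullet> (Qs i *v x)" and Qf_inner: "y \<bullet> y \<le> y \<bullet> (Qf i *v y)" for i x y
    by (rule mat_1_le_quadratic Qs_ge Qf_ge)+
  have Qs_nonneg: "0 \<le> x \<bullet> (Qs i *v x)" and Qf_nonneg: "0 \<le> y \<bullet> (Qf i *v y)" for i x y
    by (rule order_trans[OF inner_ge_zero Qs_inner] order_trans[OF inner_ge_zero Qf_inner])+

  have "\<forall>\<^sub>F K in at_top. (\<forall>i x y. 2 * (x \<bullet> (Qs i *v (A0 (A i) *v x + B1 (A i) *v y)))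
          \<le> - lams i * (x \<bullet> (Qs i *v x)) + K * (y \<bullet> (Qf i *v y))) \<and>
        (\<forall>i x y. 2 * (y \<bullet> (Qf i *v (B2 (A i) *v x + B3 (A i) *v y)))
          \<le> K * (x \<bullet> (Qs i *v x)) + K * (y \<bullet> (Qf i *v y))) \<and> 0 < K"
    unfolding A_def
    by (intro eventually_conj eventually_all_finite slow_lyapunov_decay fast_lyapunov_perturbation
        Qs Qf lams_pos Qs_lyap eventually_gt_at_top)
  then obtain K where K_slow: "\<And>i x y. 2 * (x \<bullet> (Qs i *v (A0 (A i) *v x + B1 (A i) *v y)))
          \<le> - lams i * (x \<bullet> (Qs i *v x)) + K * (y \<bullet> (Qf i *v y))"
      and K_fast: "\<And>i x y. 2 * (y \<bullet> (Qf i *v (B2 (A i) *v x + B3 (A i) *v y)))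
          \<le> K * (x \<bullet> (Qs i *v x)) + K * (y \<bullet> (Qf i *v y))" and K: "0 < K"
    using eventually_happens' trivial_limit_at_top_linorder by blast

  have "\<forall>\<^sub>F M in at_top.
        (\<forall>i j i' x y. (blk11 (R i j i') *v x + blk12 (R i j i') *v y) \<bullet>
            (Qs i' *v (blk11 (R i j i') *v x + blk12 (R i j i') *v y))
          \<le> (1 + \<gamma>\<^sup>2) / 2 * (x \<bullet> (Qs i *v x)) + M * (y \<bullet> y)) \<and>
        (\<forall>i j i' x y. (blk21 (R i j i') *v x + blk22 (R i j i') *v y) \<bullet>
            (Qf i' *v (blk21 (R i j i') *v x + blk22 (R i j i') *v y))
          \<le> M * (x \<bullet> x + y \<bullet> y)) \<and> 0 < M"
    by (intro eventually_conj eventually_all_finite contractive_jump_perturbation quadratic_form_bound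
        spectral_norm_weighted Qs Qf \<gamma> \<gamma>_ge eventually_gt_at_top)
  then obtain M where M_slow: "\<And>i j i' x y. (blk11 (R i j i') *v x + blk12 (R i j i') *v y) \<bullet>
            (Qs i' *v (blk11 (R i j i') *v x + blk12 (R i j i') *v y))
          \<le> g * (x \<bullet> (Qs i *v x)) + M * (y \<bullet> y)"
      and M_fast: "\<And>i j i' x y. (blk21 (R i j i') *v x + blk22 (R i j i') *v y) \<bullet>
            (Qf i' *v (blk21 (R i j i') *v x + blk22 (R i j i') *v y))
          \<le> M * (x \<bullet> x + y \<bullet> y)" and M: "0 < M"
    unfolding g_def using eventually_happens' trivial_limit_at_top_linorder by blast

  have "\<forall>\<^sub>F H in at_top.
        (\<forall>i (x::real^'nx) y. (mat 1 *v x + (0 :: real^'nx^'nx) *v y) \<bullet>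
            (Qs i *v (mat 1 *v x + 0 *v y)) \<le> H * (x \<bullet> x + y \<bullet> y)) \<and>
        (\<forall>i (x::real^'nz) y. (mat 1 *v x + (0 :: real^'nz^'nz) *v y) \<bullet>
            (Qf i *v (mat 1 *v x + 0 *v y)) \<le> H * (x \<bullet> x + y \<bullet> y)) \<and> 0 < H"
    by (intro eventually_conj eventually_all_finite quadratic_form_bound eventually_gt_at_top)
  \<comment> \<open>The upper bounds by \<open>H\<close> translate the initial Lyapunov value into
    the norm of the initial state; the lower bounds come from \<open>Qs_inner\<close> and
    \<open>Qf_inner\<close>.\<close>
  then obtain H where
      "\<And>i (x::real^'nx) y. (mat 1 *v x + (0 :: real^'nx^'nx) *v y) \<bullet>
          (Qs i *v (mat 1 *v x + 0 *v y)) \<le> H * (x \<bullet> x + y \<bullet> y)"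
      "\<And>i (x::real^'nz) y. (mat 1 *v x + (0 :: real^'nz^'nz) *v y) \<bullet>
          (Qf i *v (mat 1 *v x + 0 *v y)) \<le> H * (x \<bullet> x + y \<bullet> y)"
      and H: "0 < H"
    using eventually_happens' trivial_limit_at_top_linorder by blast
  from this(1)[where y = 0] this(2)[where y = 0]
  have Hs: "x \<bullet> (Qs i *v x) \<le> H * (x \<bullet> x)" and Hf: "y \<bullet> (Qf i *v y) \<le> H * (y \<bullet> y)" for i x y
    by simp_all

  \<comment> \<open>All of these depend only on \<open>g\<close> and \<open>M\<close>, hence not on
    \<epsilon>. A decay threshold \<kappa> independent of \<epsilon> is what makes the required
    dwell time proportional to \<epsilon>.\<close>
  obtain \<mu> q \<delta> \<kappa> where par: "0 < \<mu>" "0 < q" "q < 1" "0 < \<delta>" "0 < \<kappa>"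
    and contr: "\<And>e E a b. \<lbrakk>0 \<le> e; e \<le> \<delta>; 0 \<le> E; E \<le> \<kappa>; 0 \<le> a; 0 \<le> b\<rbrakk> \<Longrightarrow>
       (g + \<mu> * M) * (a + e * b) + (M + \<mu> * M) * (E * b + e * (a + e * b)) \<le> q * (a + \<mu> * b)"
    using contraction_parameters[OF g M] by blast
  \<comment> \<open>\<open>d\<close> bounds \<open>\<epsilon> * K / f\<close>; the dwell time \<open>c / f * \<epsilon>\<close> makes the factor by which \<open>w\<close> decays
    between events at most \<open>\<kappa>\<close>.\<close>
  define d where "d = min \<delta> (min 1 (l / K))"
  define c where "c = max 0 (- ln \<kappa>)"
  have d: "0 < d" "d \<le> \<delta>" "d \<le> 1" "d \<le> l / K" using par l K by (auto simp: d_def)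

  \<comment> \<open>Stability for a fixed small parameter\<close>
  have gas: "globally_asymptotically_stable (hybrid_solution S bA bJ \<epsilon> t \<sigma> \<nu>)"
    if \<epsilon>: "0 < \<epsilon>" "\<epsilon> < d * f / K" and t: "event_times t"
      and dwell: "c / f * \<epsilon> < \<tau>" "\<And>k. \<tau> \<le> t (Suc k) - t k" for \<epsilon> t \<sigma> \<nu> \<tau>
  proof (rule globally_asymptotically_stableI[OF t par(2,3)])
    define e where "e = \<epsilon> * K / f"
    have e0: "0 \<le> e" using \<epsilon> K f by (simp add: e_def)
    have "e < d" using \<epsilon> K f by (simp add: e_def field_simps)
    hence e: "e \<le> \<delta>" "e \<le> 1" "e \<le> l / K" using d by linarith+
    have eK: "e * K \<le> l" using e(3) K by (simp add: field_simps)
    have Kef: "K * \<epsilon> \<le> f" using e(2) f by (simp add: e_def field_simps)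
    show "0 < 3 * (1 + 1 / \<mu>) * (1 + \<mu>) * H"
      using par H by (intro mult_pos_pos add_pos_pos divide_pos_pos) auto
    fix x y k s
    assume sol: "hybrid_solution S bA bJ \<epsilon> t \<sigma> \<nu> x y" and s: "s \<in> {t k..<t (Suc k)}"
    define u where "u k s = x s \<bullet> (Qs (\<sigma> k) *v x s)" for k s
    define w where "w k s = y s \<bullet> (Qf (\<sigma> k) *v y s)" for k s
    \<comment> \<open>The jump condition is reindexed from \<open>k \<ge> 1\<close> to
      \<open>Suc k\<close>, so that the mode before the event becomes
      \<open>\<sigma> k\<close>.\<close>
    have "\<forall>k. \<exists>xm ym. (x \<longlongrightarrow> xm) (at_left (t (Suc k))) \<and> (y \<longlongrightarrow> ym) (at_left (t (Suc k))) \<and>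
        block_vec (x (t (Suc k))) (y (t (Suc k))) =
          R (\<sigma> k) (\<nu> (Suc k)) (\<sigma> (Suc k)) *v block_vec xm ym"
    proof
      fix k
      have "Suc k \<ge> 1" by simp
      with sol show "\<exists>xm ym. (x \<longlongrightarrow> xm) (at_left (t (Suc k))) \<and> (y \<longlongrightarrow> ym) (at_left (t (Suc k))) \<and>
        block_vec (x (t (Suc k))) (y (t (Suc k))) =
          R (\<sigma> k) (\<nu> (Suc k)) (\<sigma> (Suc k)) *v block_vec xm ym"
        unfolding hybrid_solution_def R_def by (metis diff_Suc_1)
    qed
    then obtain xm ym where lim: "\<And>k. (x \<longlongrightarrow> xm k) (at_left (t (Suc k)))"
        "\<And>k. (y \<longlongrightarrow> ym k) (at_left (t (Suc k)))"
      and jump: "\<And>k. block_vec (x (t (Suc k))) (y (t (Suc k))) =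
          R (\<sigma> k) (\<nu> (Suc k)) (\<sigma> (Suc k)) *v block_vec (xm k) (ym k)"
      by metis
    have "u k s + w k s \<le> 3 * (1 + 1 / \<mu>) * (1 + \<mu>) * q ^ k * (u 0 (t 0) + w 0 (t 0))"
    proof (rule hybrid_lyapunov_estimate[where t = t and l = l and K = K and f = f and \<epsilon> = \<epsilon> and g = g
          and M = M and e = e and E = \<kappa> and um = "\<lambda>k. xm k \<bullet> (Qs (\<sigma> k) *v xm k)"
          and wm = "\<lambda>k. ym k \<bullet> (Qf (\<sigma> k) *v ym k)"])
      show "strict_mono t" using t by (simp add: event_times_def)
      show "\<exists>u' w'. (u k has_real_derivative u') (at s within {t k..<t (Suc k)}) \<and>
          (w k has_real_derivative w') (at s within {t k..<t (Suc k)}) \<and>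
          u' \<le> - l * u k s + K * w k s \<and> w' \<le> - (f / \<epsilon>) * w k s + K * u k s"
        if ks: "s \<in> {t k..<t (Suc k)}" for k s
      proof -
        obtain x' y' where x': "(x has_vector_derivative x') (at s within {t k..<t (Suc k)})"
          and y': "(y has_vector_derivative y') (at s within {t k..<t (Suc k)})"
          and ode: "x' = A0 (A (\<sigma> k)) *v x s + B1 (A (\<sigma> k)) *v y s"
            "\<epsilon> *\<^sub>R y' = \<epsilon> *\<^sub>R (B2 (A (\<sigma> k)) *v x s) + (blk22 (A (\<sigma> k)) + \<epsilon> *\<^sub>R B3 (A (\<sigma> k))) *v y s"
          using sol[unfolded hybrid_solution_def Let_def, THEN conjunct1, rule_format, OF ks]
          unfolding A_def by blast
        have "2 * (x s \<bullet> (Qs (\<sigma> k) *v x')) \<le> - lams (\<sigma> k) * u k s + K * w k s"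
          unfolding ode(1) u_def w_def by (rule K_slow)
        also have "\<dots> \<le> - l * u k s + K * w k s"
          using l(2) Qs_nonneg by (intro add_right_mono mult_right_mono) (auto simp: u_def)
        finally have "2 * (x s \<bullet> (Qs (\<sigma> k) *v x')) \<le> - l * u k s + K * w k s" .
        moreover have "2 * (y s \<bullet> (Qf (\<sigma> k) *v y')) \<le> - (f / \<epsilon>) * w k s + K * u k s"
          unfolding u_def w_def
          by (rule fast_lyapunov_decay[OF Qf Qf_lyap[folded A_def] \<epsilon>(1) f(2) Kef K_fast ode(2)])
        ultimately show ?thesis
          using quadratic_form_has_derivative[OF Qs_sym x'] quadratic_form_has_derivative[OF Qf_sym y']
          unfolding u_def w_def by blast
      qed
      show "0 \<le> u k s" "0 \<le> w k s" for k s unfolding u_def w_def by (rule Qs_nonneg Qf_nonneg)+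
      show "(u k \<longlongrightarrow> xm k \<bullet> (Qs (\<sigma> k) *v xm k)) (at_left (t (Suc k)))"
        "(w k \<longlongrightarrow> ym k \<bullet> (Qf (\<sigma> k) *v ym k)) (at_left (t (Suc k)))" for k
        unfolding u_def w_def
        by (intro tendsto_inner lim bounded_linear.tendsto[OF matrix_vector_mul_bounded_linear])+
      fix k
      let ?R = "R (\<sigma> k) (\<nu> (Suc k)) (\<sigma> (Suc k))"
      have xy: "x (t (Suc k)) = blk11 ?R *v xm k + blk12 ?R *v ym k"
        "y (t (Suc k)) = blk21 ?R *v xm k + blk22 ?R *v ym k"
        using jump[of k] unfolding matrix_mult_block_vec block_vec_eq_iff by auto
      show "u (Suc k) (t (Suc k)) \<le> g * (xm k \<bullet> (Qs (\<sigma> k) *v xm k)) + M * (ym k \<bullet> (Qf (\<sigma> k) *v ym k))"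
        unfolding u_def xy
        by (rule order_trans[OF M_slow add_left_mono[OF mult_left_mono[OF Qf_inner]]]) (use M in simp)
      show "w (Suc k) (t (Suc k)) \<le> M * (xm k \<bullet> (Qs (\<sigma> k) *v xm k) + ym k \<bullet> (Qf (\<sigma> k) *v ym k))"
        unfolding w_def xy
        by (rule order_trans[OF M_fast mult_left_mono[OF add_mono[OF Qs_inner Qf_inner]]]) (use M in simp)
      \<comment> \<open>In the fast time scale each interval lasts longer than \<open>c\<close>, and
        \<open>c \<ge> - ln \<kappa>\<close>.\<close>
      have "c < f / \<epsilon> * \<tau>" using dwell(1) f \<epsilon> by (simp add: field_simps)
      also have "\<dots> \<le> f / \<epsilon> * (t (Suc k) - t k)"
        using dwell(2) f \<epsilon> by (intro mult_left_mono) auto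
      finally have "- (f / \<epsilon>) * (t (Suc k) - t k) \<le> ln \<kappa>" by (simp add: c_def)
      hence "exp (- (f / \<epsilon>) * (t (Suc k) - t k)) \<le> exp (ln \<kappa>)" by (simp only: exp_le_cancel_iff)
      thus "exp (- (f / \<epsilon>) * (t (Suc k) - t k)) \<le> \<kappa>" using par(5) by simp
    next
      show "(g + \<mu> * M) * (a + e * b) + (M + \<mu> * M) * (\<kappa> * b + e * (a + e * b)) \<le> q * (a + \<mu> * b)"
        if "0 \<le> a" "0 \<le> b" for a b
        by (rule contr) (use that e0 e(1) par in auto)
    qed (use \<epsilon> f K g M par e eK s in \<open>auto simp: e_def\<close>)
    also have "\<dots> \<le> 3 * (1 + 1 / \<mu>) * (1 + \<mu>) * q ^ k * (H * (norm (x 0, y 0))\<^sup>2)"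
    proof (rule mult_left_mono)
      have "t 0 = 0" using t by (simp add: event_times_def)
      thus "u 0 (t 0) + w 0 (t 0) \<le> H * (norm (x 0, y 0))\<^sup>2"
        using add_mono[OF Hs Hf, of "x 0" "\<sigma> 0" "y 0" "\<sigma> 0"]
        by (simp add: u_def w_def power2_norm_eq_inner distrib_left)
    qed (use par in auto)
    finally have "u k s + w k s \<le> 3 * (1 + 1 / \<mu>) * (1 + \<mu>) * H * q ^ k * (norm (x 0, y 0))\<^sup>2"
      by (simp only: mult_ac)
    moreover have "(norm (x s, y s))\<^sup>2 \<le> u k s + w k s"
      using add_mono[OF Qs_inner Qf_inner] by (simp add: u_def w_def power2_norm_eq_inner)
    ultimately show "(norm (x s, y s))\<^sup>2 \<le> 3 * (1 + 1 / \<mu>) * (1 + \<mu>) * H * q ^ k * (norm (x 0, y 0))\<^sup>2"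
      by linarith
  qed

  \<comment> \<open>The threshold \<open>d * f / K\<close> expresses
    \<open>\<epsilon> * K / f < d\<close>. The dwell-time bound is linear in \<epsilon>, and the
    maximum with 0 in \<open>c\<close> keeps it nonnegative.\<close>
  show ?thesis
  proof (intro exI[of _ "d * f / K"] exI[of _ "\<lambda>\<epsilon>. c / f * \<epsilon>"] conjI ballI allI impI)
    show "0 < d * f / K" using d f K by simp
    show "0 \<le> c / f * \<epsilon>" if "\<epsilon> \<in> {0<..<d * f / K}" for \<epsilon>
      using that f by (simp add: c_def)
    show "(\<lambda>\<epsilon>. c / f * \<epsilon>) \<in> O[at_right 0](\<lambda>\<epsilon>. \<epsilon>)"
      by (rule bigoI[of _ "c / f"]) (use f in \<open>auto simp: c_def abs_mult\<close>)
    show "globally_asymptotically_stable (hybrid_solution S bA bJ \<epsilon> t \<sigma> \<nu>)"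
      if "\<epsilon> \<in> {0<..<d * f / K}"
        and "event_times t \<and> (\<exists>\<tau>>c / f * \<epsilon>. \<forall>k. \<tau> \<le> t (Suc k) - t k)" for \<epsilon> t \<sigma> \<nu>
      using that gas by auto
  qed
qed

end
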